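(* For each integer $u\ge1$, let $p_u$ be the polynomial with $E[lk(L_n)^u]=p_u(n)$ for all $n>u$. If $u$ is odd, then $p_u=0$. If $u$ is even, then the coefficient $a_u$ of $n^u$ in $p_u$ is $$a_u=\sum_{P}\ \sum_{Q}\ \sum_{\varepsilon\in\{\pm1\}^u}\Big(\prod_{i=1}^u\varepsilon_i\Big)\frac{N_{P,Q,\varepsilon}}{(n_{P,Q}!)^2},$$ where $P=\{p_1,\dots,p_{u/2}\}$ and $Q=\{q_1,\dots,q_{u/2}\}$ each range over all types of length-$u$ sequences with exactly $u/2$ members, all of which satisfy $|p_h|=2$, respectively $|q_h|=2$, and $$n_{P,Q}=\sharp X_{P,Q}=\sharp Y_{P,Q}=\frac u2+\sum_{h=1}^{u/2}\big(l(p_h)+l(q_h)\big).$$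
   Context: Grid links. For a positive integer $n$ and permutations $\sigma,\pi\in S_{2n}$, write $\sigma=(x_1,\dots,x_n,x'_1,\dots,x'_n)$ and $\pi=(y_1,\dots,y_n,y'_1,\dots,y'_n)$ in one-line notation, the indices $k,l\in\{1,\dots,n\}$ of $x_k,x'_l,y_k,y'_l$ being read modulo $n$. The 2-component oriented grid link diagram $L_n^{\sigma,\pi}$ has as first component the closed polygonal path $(x_1,y_1)\to(x_1,y_2)\to(x_2,y_2)\to\cdots\to(x_n,y_n)\to(x_n,y_1)\to(x_1,y_1)$ and as second component the closed path obtained in the same way from the $x'_l,y'_l$; vertical edges cross over horizontal edges. Let $A_{k,l}=A_{k,l}^{1}$ be the condition $x_k<x'_l<x_{k+1}$, $A_{k,l}^{-1}$ the condition $x_{k+1}<x'_l<x_k$, $B_{k,l}=B_{k,l}^{1}$ the condition $y'_{l+1}<y_{k+1}<y'_l$, and $B_{k,l}^{-1}$ the condition $y'_l<y_{k+1}<y'_{l+1}$. Put $\varepsilon_{k,l}^{\sigma,\pi}=\delta\delta'$ if $A_{k,l}^{\delta}$ and $B_{k,l}^{\delta'}$ hold for some $\delta,\delta'\in\{\pm1\}$, and $\varepsilon_{k,l}^{\sigma,\pi}=0$ otherwise. The linking number (sum of the signs of the crossings where the first component passes under the second) is $lk(L_n^{\sigma,\pi})=\sum_{k,l=1}^n\varepsilon_{k,l}^{\sigma,\pi}$. The random link $L_n$ is $L_n^{\sigma,\pi}$ with $\sigma,\pi\in S_{2n}$ independent and uniform. For every $u\ge1$, the moment $E[lk(L_n)^u]$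 agrees for all $n>u$ with a polynomial in $n$ of degree at most $u$. Types. Let $u<n$ and $\mathbf k=(k_1,\dots,k_u)\in\{1,\dots,n\}^u$. The type of $\mathbf k$ is a set $P=\{p_1,\dots,p_s\}$ of sequences of nonempty subsets of $\{1,\dots,u\}$ in which each $i\in\{1,\dots,u\}$ appears exactly once, defined by: $i,j$ are in the same subset if $k_i=k_j$; $j$ is in the subset immediately following the one containing $i$ in the same sequence if $k_i+1\equiv k_j \bmod n$; $i,j$ are in different sequences if they are not forced together in this way. Equivalently: split the set of values $\{k_1,\dots,k_u\}\subset\mathbb{Z}/n$ into maximal runs $a,a+1,\dots,a+t-1$ of cyclically consecutive residues; each run yields one sequence $(\{i:k_i\equiv a\},\{i:k_i\equiv a+1\},\dots,\{i:k_i\equiv a+t-1\})$, and $P$ is the set of these sequences. For a sequence $p$ of subsets, $l(p)$ is its length (number of subsets) and $|p|$ is the total number of elements of $\{1,\dots,u\}$ occurring in it. Thus the sums range over all sets $P$ (resp. $Q$) of $u/2$ sequences with two elements each, every such sequence being of the form $(\{i,j\})$ or $(\{i\},\{j\})$, with each element of $\{1,\dots,u\}$ occurring exactly once. Arrangements. Given such $P,Q$, take any $n\ge 2u$, any $\mathbf k\in\{1,\dots,n\}^u$ of type $P$ and any $\mathbf l\in\{1,\dots,n\}^u$ of type $Q$. Let $X_{P,Q}=\{x_{k_i},x_{k_i+1},x'_{l_i}: 1\le i\le u\}$ and $Y_{P,Q}=\{y_{k_i+1},y'_{l_i},y'_{l_i+1}:1\le i\le u\}$, regarded as sets of symbols (symbols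 with the same index modulo $n$ being identified). For $\varepsilon=(\varepsilon_1,\dots,\varepsilon_u)\in\{\pm1\}^u$, $N_{P,Q,\varepsilon}$ is the number of pairs consisting of a total order on $X_{P,Q}$ and a total order on $Y_{P,Q}$ for which $\varepsilon_{k_i,l_i}=\varepsilon_i$ holds for all $i=1,\dots,u$ (with $\varepsilon_{k,l}$ computed from these orders through the conditions $A_{k,l}^{\pm1},B_{k,l}^{\pm1}$). These quantities do not depend on the choice of $n,\mathbf k,\mathbf l$. *)

theory Defs
  imports "HOL-Probability.Probability" "HOL-Combinatorics.Permutations"
begin

section \<open>Grid links\<close>

text \<open>Indices live in \<open>{1..n}\<close>, and \<open>cyc n k\<close> is \<open>k + 1\<close> read modulo \<open>n\<close>.\<close>

definition cyc :: "nat \<Rightarrow> nat \<Rightarrow> nat" where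
  "cyc n k = k mod n + 1"

type_synonym point = "int \<times> int"
type_synonym edge = "point \<times> point"

text \<open>The closed path \<open>(x\<^sub>1,y\<^sub>1) \<rightarrow> (x\<^sub>1,y\<^sub>2) \<rightarrow> (x\<^sub>2,y\<^sub>2) \<rightarrow> \<dots> \<rightarrow> (x\<^sub>n,y\<^sub>1) \<rightarrow> (x\<^sub>1,y\<^sub>1)\<close>
  traverses, for \<open>k = 1, \<dots>, n\<close>, first the \<open>k\<close>-th vertical and then the \<open>k\<close>-th horizontal edge.\<close>

definition vertical_edge :: "nat \<Rightarrow> (nat \<Rightarrow> nat) \<Rightarrow> (nat \<Rightarrow> nat) \<Rightarrow> nat \<Rightarrow> edge" where
  "vertical_edge n x y k = ((int (x k), int (y k)), (int (x k), int (y (cyc n k))))"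

definition horizontal_edge :: "nat \<Rightarrow> (nat \<Rightarrow> nat) \<Rightarrow> (nat \<Rightarrow> nat) \<Rightarrow> nat \<Rightarrow> edge" where
  "horizontal_edge n x y k =
     ((int (x k), int (y (cyc n k))), (int (x (cyc n k)), int (y (cyc n k))))"

text \<open>Contribution of a vertical edge and a horizontal edge: 0 if they do not cross, otherwise
  the sign of the crossing, which is the sign of the determinant of the direction of the
  overcrossing strand (always the vertical one) and that of the undercrossing strand.\<close>

fun crossing_sign :: "edge \<Rightarrow> edge \<Rightarrow> int" where
  "crossing_sign ((vx1, vy1), (vx2, vy2)) ((hx1, hy1), (hx2, hy2)) =
     (if min hx1 hx2 < vx1 \<and> vx1 < max hx1 hx2 \<and> min vy1 vy2 < hy1 \<and> hy1 < max vy1 vy2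
      then sgn ((vx2 - vx1) * (hy2 - hy1) - (vy2 - vy1) * (hx2 - hx1)) else 0)"

text \<open>In \<open>S\<^sub>2\<^sub>n\<close>, realised as permutations of \<open>{1..2*n}\<close>, the one-line notation of \<open>\<sigma>\<close> gives
  \<open>x\<^sub>k = \<sigma> k\<close> and \<open>x'\<^sub>l = \<sigma> (n + l)\<close>; likewise for \<open>\<pi>\<close>. Only crossings where the first component
  passes under the second are counted, so the horizontal edge belongs to the first component.\<close>

definition lk :: "nat \<Rightarrow> (nat \<Rightarrow> nat) \<Rightarrow> (nat \<Rightarrow> nat) \<Rightarrow> int" where
  "lk n \<sigma> \<pi> = (\<Sum>k=1..n. \<Sum>l=1..n.
     crossing_sign (vertical_edge n (\<lambda>i. \<sigma> (n + i)) (\<lambda>i. \<pi> (n + i)) l) (horizontal_edge n \<sigma> \<pi> k))"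

definition random_grid :: "nat \<Rightarrow> ((nat \<Rightarrow> nat) \<times> (nat \<Rightarrow> nat)) pmf" where
  "random_grid n =
     (let S = {\<sigma>. \<sigma> permutes {1..2*n}} in pair_pmf (pmf_of_set S) (pmf_of_set S))"

definition lk_moment :: "nat \<Rightarrow> nat \<Rightarrow> real" where
  "lk_moment u n =
     measure_pmf.expectation (random_grid n) (\<lambda>(\<sigma>, \<pi>). real_of_int (lk n \<sigma> \<pi>) ^ u)"


section \<open>The signs in terms of orders on coordinate symbols\<close>

text \<open>\<open>Fst k\<close> stands for the symbol \<open>x\<^sub>k\<close> (or \<open>y\<^sub>k\<close>), \<open>Snd l\<close> for \<open>x'\<^sub>l\<close> (or \<open>y'\<^sub>l\<close>). The conditions
  take the strict order on the \<open>x\<close>-symbols, resp. \<open>y\<close>-symbols, as a parameter.\<close>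

datatype symb = Fst nat | Snd nat

definition condA :: "nat \<Rightarrow> (symb \<Rightarrow> symb \<Rightarrow> bool) \<Rightarrow> int \<Rightarrow> nat \<Rightarrow> nat \<Rightarrow> bool" where
  "condA n lt \<delta> k l \<longleftrightarrow>
     (\<delta> = 1 \<and> lt (Fst k) (Snd l) \<and> lt (Snd l) (Fst (cyc n k))) \<or>
     (\<delta> = -1 \<and> lt (Fst (cyc n k)) (Snd l) \<and> lt (Snd l) (Fst k))"

definition condB :: "nat \<Rightarrow> (symb \<Rightarrow> symb \<Rightarrow> bool) \<Rightarrow> int \<Rightarrow> nat \<Rightarrow> nat \<Rightarrow> bool" where
  "condB n lt \<delta> k l \<longleftrightarrow>
     (\<delta> = 1 \<and> lt (Snd (cyc n l)) (Fst (cyc n k)) \<and> lt (Fst (cyc n k)) (Snd l)) \<or>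
     (\<delta> = -1 \<and> lt (Snd l) (Fst (cyc n k)) \<and> lt (Fst (cyc n k)) (Snd (cyc n l)))"

definition eps :: "nat \<Rightarrow> (symb \<Rightarrow> symb \<Rightarrow> bool) \<Rightarrow> (symb \<Rightarrow> symb \<Rightarrow> bool) \<Rightarrow> nat \<Rightarrow> nat \<Rightarrow> int" where
  "eps n ltx lty k l =
     (if (condA n ltx 1 k l \<and> condB n lty 1 k l) \<or> (condA n ltx (-1) k l \<and> condB n lty (-1) k l)
      then 1
      else if (condA n ltx 1 k l \<and> condB n lty (-1) k l) \<or> (condA n ltx (-1) k l \<and> condB n lty 1 k l)
      then -1
      else 0)"

primrec symb_val :: "nat \<Rightarrow> (nat \<Rightarrow> nat) \<Rightarrow> symb \<Rightarrow> nat" where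
  "symb_val n \<sigma> (Fst k) = \<sigma> k"
| "symb_val n \<sigma> (Snd l) = \<sigma> (n + l)"

definition perm_less :: "nat \<Rightarrow> (nat \<Rightarrow> nat) \<Rightarrow> symb \<Rightarrow> symb \<Rightarrow> bool" where
  "perm_less n \<sigma> a b \<longleftrightarrow> symb_val n \<sigma> a < symb_val n \<sigma> b"

lemma lk_eq_sum_eps:
  "lk n \<sigma> \<pi> = (\<Sum>k=1..n. \<Sum>l=1..n. eps n (perm_less n \<sigma>) (perm_less n \<pi>) k l)"
  unfolding lk_def
  by (intro sum.cong refl)
     (auto simp: vertical_edge_def horizontal_edge_def eps_def condA_def condB_def perm_less_def
        min_def max_def sgn_if mult_less_0_iff zero_less_mult_iff split: if_splits)


section \<open>Types\<close>

text \<open>A type of sequences of length \<open>u\<close>: a set of nonempty sequences of nonempty subsets of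
  \<open>{1..u}\<close> in which every \<open>i\<close> occurs exactly once.\<close>

definition is_type :: "nat \<Rightarrow> nat set list set \<Rightarrow> bool" where
  "is_type u P \<longleftrightarrow>
     (\<forall>p\<in>P. p \<noteq> [] \<and> (\<forall>A\<in>set p. A \<noteq> {} \<and> A \<subseteq> {1..u})) \<and>
     (\<forall>i\<in>{1..u}. \<exists>!(p, j). p \<in> P \<and> j < length p \<and> i \<in> p ! j)"

text \<open>The number \<open>|p|\<close>.\<close>

definition weight :: "nat set list \<Rightarrow> nat" where
  "weight p = card (\<Union>(set p))"

text \<open>\<open>a, a + 1, \<dots>, a + t - 1\<close> (modulo \<open>n\<close>) is a maximal run of cyclically consecutive elements
  of \<open>V\<close>; meaningful for \<open>V\<close> a proper subset of \<open>{1..n}\<close>.\<close>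

definition maximal_run :: "nat \<Rightarrow> nat set \<Rightarrow> nat \<Rightarrow> nat \<Rightarrow> bool" where
  "maximal_run n V a t \<longleftrightarrow>
     0 < t \<and> (\<forall>j<t. (cyc n ^^ j) a \<in> V) \<and> (cyc n ^^ t) a \<notin> V \<and> (\<forall>b\<in>V. cyc n b \<noteq> a)"

text \<open>The type of \<open>k \<in> {1..n}\<^sup>u\<close>, for \<open>u < n\<close>.\<close>

definition type_of :: "nat \<Rightarrow> nat \<Rightarrow> (nat \<Rightarrow> nat) \<Rightarrow> nat set list set" where
  "type_of n u k =
     {map (\<lambda>j. {i\<in>{1..u}. k i = (cyc n ^^ j) a}) [0..<t] | a t. maximal_run n (k ` {1..u}) a t}"

definition pair_types :: "nat \<Rightarrow> nat set list set set" where
  "pair_types u = {P. is_type u P \<and> card P = u div 2 \<and> (\<forall>p\<in>P. weight p = 2)}"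


section \<open>Arrangements\<close>

definition symbX :: "nat \<Rightarrow> nat \<Rightarrow> (nat \<Rightarrow> nat) \<Rightarrow> (nat \<Rightarrow> nat) \<Rightarrow> symb set" where
  "symbX n u k l = (\<Union>i\<in>{1..u}. {Fst (k i), Fst (cyc n (k i)), Snd (l i)})"

definition symbY :: "nat \<Rightarrow> nat \<Rightarrow> (nat \<Rightarrow> nat) \<Rightarrow> (nat \<Rightarrow> nat) \<Rightarrow> symb set" where
  "symbY n u k l = (\<Union>i\<in>{1..u}. {Fst (cyc n (k i)), Snd (l i), Snd (cyc n (l i))})"

definition strict :: "'a rel \<Rightarrow> 'a \<Rightarrow> 'a \<Rightarrow> bool" where
  "strict r a b \<longleftrightarrow> (a, b) \<in> r \<and> a \<noteq> b"

definition arrangements ::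
  "nat \<Rightarrow> nat \<Rightarrow> (nat \<Rightarrow> nat) \<Rightarrow> (nat \<Rightarrow> nat) \<Rightarrow> (nat \<Rightarrow> int) \<Rightarrow> (symb rel \<times> symb rel) set" where
  "arrangements n u k l \<epsilon> =
     {(r, s). linear_order_on (symbX n u k l) r \<and> linear_order_on (symbY n u k l) s \<and>
        (\<forall>i\<in>{1..u}. eps n (strict r) (strict s) (k i) (l i) = \<epsilon> i)}"

definition represents ::
  "nat \<Rightarrow> (nat \<Rightarrow> nat) \<Rightarrow> (nat \<Rightarrow> nat) \<Rightarrow> nat \<Rightarrow> nat set list set \<Rightarrow> nat set list set \<Rightarrow> bool" where
  "represents n k l u P Q \<longleftrightarrow>
     2 * u \<le> n \<and> k \<in> {1..u} \<rightarrow>\<^sub>E {1..n} \<and> l \<in> {1..u} \<rightarrow>\<^sub>E {1..n} \<and>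
     type_of n u k = P \<and> type_of n u l = Q"

text \<open>\<open>N\<^sub>P\<^sub>,\<^sub>Q\<^sub>,\<^sub>\<epsilon>\<close>: the common number of arrangements over all representatives of \<open>P\<close> and \<open>Q\<close>.\<close>

definition num_arr ::
  "nat \<Rightarrow> nat set list set \<Rightarrow> nat set list set \<Rightarrow> (nat \<Rightarrow> int) \<Rightarrow> nat" where
  "num_arr u P Q \<epsilon> =
     (THE c. \<forall>n k l. represents n k l u P Q \<longrightarrow> card (arrangements n u k l \<epsilon>) = c)"

definition num_symb :: "nat \<Rightarrow> nat set list set \<Rightarrow> nat set list set \<Rightarrow> nat" where
  "num_symb u P Q = u div 2 + ((\<Sum>p\<in>P. length p) + (\<Sum>q\<in>Q. length q))"

end

theory Submission
  imports Defs
begin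

text \<open>
  Expanding \<open>lk\<^sup>u\<close> writes the \<open>u\<close>-th moment as a sum, over pairs of index sequences
  \<open>k, l \<in> {1..n}\<^sup>u\<close>, of the expectation of the product of the \<open>\<epsilon>\<close> at \<open>(k\<^sub>i, l\<^sub>i)\<close>. If the type
  of \<open>k\<close> has a member of weight 1, say \<open>({i})\<close>, then exchanging the values \<open>x\<close> at \<open>k\<^sub>i\<close> and
  \<open>k\<^sub>i + 1\<close> flips exactly one factor of the product, so the expectation vanishes; for \<open>l\<close> one
  exchanges two consecutive \<open>y'\<close>. A type with \<open>s\<close> members is determined by the starting points of
  its \<open>s\<close> runs, hence occurs asymptotically \<open>n\<^sup>s\<close> times. So only types all of whose members have weight
  at least 2 contribute, \<open>s \<le> u / 2\<close> for them, and the order \<open>n\<^sup>u\<close> is reached only if all weights on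
  both sides are 2. For such a pair of types the expectation is a sum over sign patterns of the
  probability that random orders on the symbols realise the pattern, and a uniform permutation
  induces each linear order on a set of \<open>m\<close> symbols with probability \<open>1 / m!\<close>. For odd \<open>u\<close>,
  reversing all \<open>x\<close> and \<open>x'\<close> values negates the linking number.
\<close>

subsection \<open>Linear orders induced by permutations\<close>

text \<open>\<open>r\<close> is meant to be reflexive, so an element counts itself and ranks start
  at 1, not 0.\<close>

definition order_rank :: "'a rel \<Rightarrow> 'a \<Rightarrow> nat" where
  "order_rank r a = card {b. (b, a) \<in> r}"

lemma linear_order_onD:
  assumes "linear_order_on X r"
  shows "r \<subseteq> X \<times> X" "\<And>a. a \<in> X \<Longrightarrow> (a, a) \<in> r"
    "\<And>a b c. (a, b) \<in> r \<Longrightarrow> (b, c) \<in> r \<Longrightarrow> (a, c) \<in> r"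
    "\<And>a b. (a, b) \<in> r \<Longrightarrow> (b, a) \<in> r \<Longrightarrow> a = b"
    "\<And>a b. a \<in> X \<Longrightarrow> b \<in> X \<Longrightarrow> (a, b) \<in> r \<or> (b, a) \<in> r"
proof -
  have L: "r \<subseteq> X \<times> X" "refl_on X r" "trans r" "antisym r" "total_on X r"
    using assms unfolding linear_order_on_def partial_order_on_def preorder_on_def by auto
  show "r \<subseteq> X \<times> X" by (rule L(1))
  show "(a, a) \<in> r" if "a \<in> X" for a using L(2) that unfolding refl_on_def by blast
  show "(a, c) \<in> r" if "(a, b) \<in> r" "(b, c) \<in> r" for a b c using L(3) that by (rule transD)
  show "a = b" if "(a, b) \<in> r" "(b, a) \<in> r" for a b using L(4) that by (rule antisymD)
  show "(a, b) \<in> r \<or> (b, a) \<in> r" if "a \<in> X" "b \<in> X" for a b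
    using L(2,5) that unfolding total_on_def refl_on_def by (cases "a = b") auto
qed

lemma linear_order_onI:
  assumes "r \<subseteq> X \<times> X" "\<And>a. a \<in> X \<Longrightarrow> (a, a) \<in> r"
    "\<And>a b c. (a, b) \<in> r \<Longrightarrow> (b, c) \<in> r \<Longrightarrow> (a, c) \<in> r"
    "\<And>a b. (a, b) \<in> r \<Longrightarrow> (b, a) \<in> r \<Longrightarrow> a = b"
    "\<And>a b. a \<in> X \<Longrightarrow> b \<in> X \<Longrightarrow> (a, b) \<in> r \<or> (b, a) \<in> r"
  shows "linear_order_on X r"
  unfolding linear_order_on_def partial_order_on_def preorder_on_def refl_on_def total_on_def
proof (intro conjI ballI impI)
  show "trans r" using assms(3) by (rule transI)
  show "antisym r" using assms(4) by (rule antisymI)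
qed (use assms(1,2,5) in auto)

text \<open>Down-sets of a linear order are nested. If \<open>a\<close> is not below
  \<open>b\<close>, the down-set of \<open>b\<close> is contained in that of \<open>a\<close> and
  misses \<open>a\<close> itself, so it is strictly smaller.\<close>

lemma order_rank_le_iff:
  assumes "finite X" "linear_order_on X r" "a \<in> X" "b \<in> X"
  shows "order_rank r a \<le> order_rank r b \<longleftrightarrow> (a, b) \<in> r"
proof -
  note L = linear_order_onD[OF assms(2)]
  have fin: "finite {c. (c, b) \<in> r}" for b
    using L(1) by (intro finite_subset[OF _ assms(1)]) auto
  have le: "order_rank r a \<le> order_rank r b" if "(a, b) \<in> r" for a b
    unfolding order_rank_def using L(3) that by (intro card_mono fin) blast
  have lt: "order_rank r b < order_rank r a" if "(a, b) \<notin> r"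
    unfolding order_rank_def
  proof (intro psubset_card_mono fin psubsetI)
    have "(b, a) \<in> r" using L(5) assms that by blast
    then show "{c. (c, b) \<in> r} \<subseteq> {c. (c, a) \<in> r}" using L(3) by blast
    show "{c. (c, b) \<in> r} \<noteq> {c. (c, a) \<in> r}" using L(2)[OF assms(3)] that by blast
  qed
  show ?thesis using le lt by fastforce
qed

lemma order_rank_bij_betw:
  assumes "finite X" "linear_order_on X r"
  shows "bij_betw (order_rank r) X {1..card X}"
proof -
  note L = linear_order_onD[OF assms(2)]
  have inj: "inj_on (order_rank r) X"
  proof (rule inj_onI)
    fix a b assume "a \<in> X" "b \<in> X" "order_rank r a = order_rank r b"
    then show "a = b" using order_rank_le_iff[OF assms, of a b] order_rank_le_iff[OF assms, of b a] L(4)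
      by simp
  qed
  have "order_rank r ` X \<subseteq> {1..card X}"
  proof (intro image_subsetI)
    fix a assume a: "a \<in> X"
    have "{b. (b, a) \<in> r} \<subseteq> X" "a \<in> {b. (b, a) \<in> r}" using L(1,2) a by auto
    then have "card {b. (b, a) \<in> r} \<le> card X" "card {b. (b, a) \<in> r} > 0"
      using assms(1) by (auto intro: card_mono simp: card_gt_0_iff finite_subset)
    then show "order_rank r a \<in> {1..card X}" unfolding order_rank_def by simp
  qed
  then have "order_rank r ` X = {1..card X}"
    by (intro card_subset_eq) (auto simp: card_image inj)
  then show ?thesis using inj by (simp add: bij_betw_def)
qed

text \<open>Rank identifies each of the two orders with \<open>{1..card X}\<close>. Following one
  rank map by the inverse of the other gives the isomorphism, extended by the identity outside
  \<open>X\<close>.\<close>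

lemma linear_orders_isomorphic:
  assumes "finite X" "linear_order_on X r" "linear_order_on X r'"
  obtains \<tau> where "\<tau> permutes X"
    "\<And>a b. a \<in> X \<Longrightarrow> b \<in> X \<Longrightarrow> (\<tau> a, \<tau> b) \<in> r \<longleftrightarrow> (a, b) \<in> r'"
proof -
  let ?f = "order_rank r" and ?g = "order_rank r'"
  define \<tau> where "\<tau> a = (if a \<in> X then inv_into X ?f (?g a) else a)" for a
  have bf: "bij_betw ?f X {1..card X}" and bg: "bij_betw ?g X {1..card X}"
    using order_rank_bij_betw assms by auto
  have "bij_betw (inv_into X ?f \<circ> ?g) X X"
    using bij_betw_trans[OF bg bij_betw_inv_into[OF bf]] .
  moreover have "bij_betw \<tau> X X = bij_betw (inv_into X ?f \<circ> ?g) X X"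
    by (rule bij_betw_cong) (simp add: \<tau>_def)
  ultimately have b: "bij_betw \<tau> X X" by simp
  have P: "\<tau> permutes X" by (rule bij_imp_permutes[OF b]) (simp add: \<tau>_def)
  have ft: "?f (\<tau> a) = ?g a" if "a \<in> X" for a
    using bij_betw_inv_into_right[OF bf, of "?g a"] bij_betwE[OF bg] that by (simp add: \<tau>_def)
  show ?thesis
  proof (rule that[OF P])
    fix a b assume ab: "a \<in> X" "b \<in> X"
    then have "\<tau> a \<in> X" "\<tau> b \<in> X" using permutes_in_image[OF P] by auto
    then show "(\<tau> a, \<tau> b) \<in> r \<longleftrightarrow> (a, b) \<in> r'"
      using order_rank_le_iff[OF assms(1,2), of "\<tau> a" "\<tau> b"]
        order_rank_le_iff[OF assms(1,3), of a b] ft ab by simp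
  qed
qed

definition order_on_of :: "'a set \<Rightarrow> ('a \<Rightarrow> nat) \<Rightarrow> 'a rel" where
  "order_on_of X f = {(a, b). a \<in> X \<and> b \<in> X \<and> f a \<le> f b}"

lemma linear_order_on_order_on_of:
  assumes "inj_on f X"
  shows "linear_order_on X (order_on_of X f)"
  by (rule linear_order_onI) (use assms in \<open>auto simp: order_on_of_def inj_on_def\<close>)

lemma finite_linear_orders: "finite X \<Longrightarrow> finite {r. linear_order_on X r}"
  by (rule finite_subset[of _ "Pow (X \<times> X)"]) (auto dest: linear_order_onD(1))

text \<open>Fix one order \<open>r0\<close> and pull it back along permutations of \<open>X\<close>.
  Every linear order arises, since any two are isomorphic, and it arises only once, since its ranks
  recover the permutation.\<close>

lemma card_linear_orders:
  assumes "finite X"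
  shows "card {r. linear_order_on X r} = fact (card X)"
proof -
  \<comment> \<open>The type of the elements carries no order, so the reference order is borrowed
    from the natural numbers.\<close>
  obtain f :: "'a \<Rightarrow> nat" where f: "inj_on f X"
    using finite_imp_inj_to_nat_seg[OF assms] by blast
  define r0 where "r0 = order_on_of X f"
  have r0: "linear_order_on X r0" unfolding r0_def by (rule linear_order_on_order_on_of[OF f])
  define F where "F \<tau> = order_on_of X (\<lambda>a. order_rank r0 (\<tau> a))" for \<tau> :: "'a \<Rightarrow> 'a"
  have F: "(a, b) \<in> F \<tau> \<longleftrightarrow> a \<in> X \<and> b \<in> X \<and> (\<tau> a, \<tau> b) \<in> r0" if "\<tau> permutes X" for \<tau> a b
    using order_rank_le_iff[OF assms r0, of "\<tau> a" "\<tau> b"] permutes_in_image[OF that]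
    by (auto simp: F_def order_on_of_def)
  have injr: "inj_on (order_rank r0) X"
    using order_rank_bij_betw[OF assms r0] bij_betw_def by blast
  have lin: "linear_order_on X (F \<tau>)" if "\<tau> permutes X" for \<tau>
    unfolding F_def
  proof (rule linear_order_on_order_on_of, rule inj_onI)
    fix a b assume "a \<in> X" "b \<in> X" "order_rank r0 (\<tau> a) = order_rank r0 (\<tau> b)"
    then have "\<tau> a = \<tau> b" using injr permutes_in_image[OF that] by (auto simp: inj_on_def)
    then show "a = b" using permutes_inj[OF that] by (auto dest: injD)
  qed
  \<comment> \<open>\<open>\<tau>\<close> maps the down-set of \<open>a\<close> in the pulled-back
    order bijectively onto the down-set of \<open>\<tau> a\<close> in \<open>r0\<close>. This is
    what makes \<open>F\<close> injective.\<close>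
  have rank: "order_rank (F \<tau>) a = order_rank r0 (\<tau> a)" if "\<tau> permutes X" "a \<in> X" for \<tau> a
  proof -
    have "bij_betw \<tau> {b. (b, a) \<in> F \<tau>} {c. (c, \<tau> a) \<in> r0}"
    proof (rule bij_betw_imageI)
      show "inj_on \<tau> {b. (b, a) \<in> F \<tau>}" using permutes_inj_on[OF that(1)] .
      have "c \<in> \<tau> ` {b. (b, a) \<in> F \<tau>}" if c: "(c, \<tau> a) \<in> r0" for c
      proof -
        have "c \<in> X" using c linear_order_onD(1)[OF r0] by auto
        then obtain b where "b \<in> X" "c = \<tau> b" using permutes_image[OF \<open>\<tau> permutes X\<close>] by blast
        then show ?thesis using c F[OF \<open>\<tau> permutes X\<close>] \<open>a \<in> X\<close> by auto
      qed
      then show "\<tau> ` {b. (b, a) \<in> F \<tau>} = {c. (c, \<tau> a) \<in> r0}" using F[OF that(1)] by auto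
    qed
    then show ?thesis unfolding order_rank_def by (rule bij_betw_same_card)
  qed
  have "bij_betw F {\<tau>. \<tau> permutes X} {r. linear_order_on X r}"
  proof (rule bij_betw_imageI)
    show "inj_on F {\<tau>. \<tau> permutes X}"
    proof (rule inj_onI, clarify)
      fix \<tau> \<tau>' assume t: "\<tau> permutes X" "\<tau>' permutes X" and eq: "F \<tau> = F \<tau>'"
      show "\<tau> = \<tau>'"
      proof
        fix a
        show "\<tau> a = \<tau>' a"
        proof (cases "a \<in> X")
          case True
          then have "order_rank r0 (\<tau> a) = order_rank r0 (\<tau>' a)" using rank t eq by metis
          then show ?thesis using injr True permutes_in_image t by (metis inj_onD)
        qed (use t in \<open>auto simp: permutes_not_in\<close>)
      qed
    qed
    show "F ` {\<tau>. \<tau> permutes X} = {r. linear_order_on X r}"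
    proof (intro equalityI subsetI)
      fix r assume "r \<in> {r. linear_order_on X r}"
      then have r: "linear_order_on X r" by simp
      obtain \<tau> where t: "\<tau> permutes X"
        "\<And>a b. a \<in> X \<Longrightarrow> b \<in> X \<Longrightarrow> (\<tau> a, \<tau> b) \<in> r0 \<longleftrightarrow> (a, b) \<in> r"
        using linear_orders_isomorphic[OF assms r0 r] by blast
      have "F \<tau> = r" using F[OF t(1)] t(2) linear_order_onD(1)[OF r] by auto
      then show "r \<in> F ` {\<tau>. \<tau> permutes X}" using t(1) by blast
    qed (use lin in auto)
  qed
  then show ?thesis using bij_betw_same_card card_permutations[OF refl assms] by metis
qed

text \<open>Any two linear orders on \<open>X\<close> differ by a permutation of \<open>X\<close>, hence are induced by
  equally many permutations of \<open>U\<close>.\<close>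

lemma card_permutations_inducing_order:
  fixes U :: "nat set"
  assumes U: "finite U" and \<iota>: "inj_on \<iota> X" "\<iota> ` X \<subseteq> U" and r: "linear_order_on X r"
  shows "card {\<sigma>. \<sigma> permutes U \<and> order_on_of X (\<sigma> \<circ> \<iota>) = r} * fact (card X) = fact (card U)"
proof -
  have X: "finite X" using finite_subset[OF \<iota>(2) U] finite_imageD \<iota>(1) by blast
  let ?S = "\<lambda>r. {\<sigma>. \<sigma> permutes U \<and> order_on_of X (\<sigma> \<circ> \<iota>) = r}"
  have fin: "finite (?S r)" for r using finite_permutations[OF U] by simp
  \<comment> \<open>The claim is symmetric in \<open>r\<close> and \<open>r'\<close>, so an
    inequality already gives equality of the two cardinalities.\<close>
  have le: "card (?S r) \<le> card (?S r')" if r: "linear_order_on X r" and r': "linear_order_on X r'" for r r'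
  proof -
    obtain \<tau> where t: "\<tau> permutes X"
      "\<And>a b. a \<in> X \<Longrightarrow> b \<in> X \<Longrightarrow> (\<tau> a, \<tau> b) \<in> r \<longleftrightarrow> (a, b) \<in> r'"
      using linear_orders_isomorphic[OF X r r'] by blast
    \<comment> \<open>\<open>\<theta>\<close> is \<open>\<tau>\<close> transported along
      \<open>\<iota>\<close> to the positions of \<open>X\<close>, all other positions being fixed.
      Precomposing with it turns permutations inducing \<open>r\<close> into permutations inducing
      \<open>r'\<close>.\<close>
    define \<theta> where "\<theta> m = (if m \<in> \<iota> ` X then \<iota> (\<tau> (inv_into X \<iota> m)) else m)" for m
    have "bij_betw (\<iota> \<circ> \<tau> \<circ> inv_into X \<iota>) (\<iota> ` X) (\<iota> ` X)"
      by (intro bij_betw_trans[OF bij_betw_inv_into bij_betw_trans[OF permutes_imp_bij[OF t(1)]]])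
        (use \<iota>(1) in \<open>auto simp: bij_betw_def\<close>)
    moreover have "bij_betw \<theta> (\<iota> ` X) (\<iota> ` X) = bij_betw (\<iota> \<circ> \<tau> \<circ> inv_into X \<iota>) (\<iota> ` X) (\<iota> ` X)"
      by (rule bij_betw_cong) (simp add: \<theta>_def)
    ultimately have "\<theta> permutes (\<iota> ` X)" by (intro bij_imp_permutes) (auto simp: \<theta>_def)
    then have th: "\<theta> permutes U" using permutes_subset \<iota>(2) by blast
    have th_i: "\<theta> (\<iota> a) = \<iota> (\<tau> a)" if "a \<in> X" for a using that \<iota>(1) by (simp add: \<theta>_def)
    have inj: "inj_on (\<lambda>\<sigma>. \<sigma> \<circ> \<theta>) (?S r)"
    proof (rule inj_onI)
      fix \<sigma> \<sigma>' :: "nat \<Rightarrow> nat" assume "\<sigma> \<circ> \<theta> = \<sigma>' \<circ> \<theta>"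
      then have "\<sigma> \<circ> \<theta> \<circ> inv \<theta> = \<sigma>' \<circ> \<theta> \<circ> inv \<theta>" by simp
      then show "\<sigma> = \<sigma>'" using permutes_inv_o(1)[OF th] by (simp add: comp_assoc)
    qed
    have "\<sigma> \<circ> \<theta> \<in> ?S r'" if s: "\<sigma> \<in> ?S r" for \<sigma>
    proof -
      have "(a, b) \<in> order_on_of X (\<sigma> \<circ> \<theta> \<circ> \<iota>) \<longleftrightarrow> (a, b) \<in> r'" for a b
      proof (cases "a \<in> X \<and> b \<in> X")
        case True
        then have "\<tau> a \<in> X" "\<tau> b \<in> X" using permutes_in_image[OF t(1)] by auto
        then have "\<sigma> (\<iota> (\<tau> a)) \<le> \<sigma> (\<iota> (\<tau> b)) \<longleftrightarrow> (\<tau> a, \<tau> b) \<in> r" using s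
          by (auto simp: order_on_of_def)
        then show ?thesis using t(2) True th_i by (auto simp: order_on_of_def)
      qed (use linear_order_onD(1)[OF r'] in \<open>auto simp: order_on_of_def\<close>)
      then have "order_on_of X (\<sigma> \<circ> \<theta> \<circ> \<iota>) = r'" by auto
      then show ?thesis using s permutes_compose[OF th] by auto
    qed
    then show ?thesis by (intro card_inj_on_le[OF inj _ fin]) auto
  qed
  have "fact (card U) = card {\<sigma>. \<sigma> permutes U}" using card_permutations[OF refl U] by simp
  \<comment> \<open>Each permutation induces exactly one linear order, so the permutations split
    into \<open>fact (card X)\<close> classes, which are equally large by \<open>le\<close>.\<close>
  also have "{\<sigma>. \<sigma> permutes U} = (\<Union>r\<in>{r. linear_order_on X r}. ?S r)"
  proof -
    have "linear_order_on X (order_on_of X (\<sigma> \<circ> \<iota>))" if "\<sigma> permutes U" for \<sigma>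
      by (intro linear_order_on_order_on_of comp_inj_on \<iota>(1) permutes_inj_on[OF that])
    then show ?thesis by auto
  qed
  also have "card \<dots> = (\<Sum>r'\<in>{r. linear_order_on X r}. card (?S r'))"
    using finite_linear_orders[OF X] fin by (intro card_UN_disjoint) auto
  also have "\<dots> = (\<Sum>r'\<in>{r. linear_order_on X r}. card (?S r))"
    using le r by (intro sum.cong refl order_antisym) auto
  also have "\<dots> = card (?S r) * fact (card X)" using card_linear_orders[OF X] by simp
  finally show ?thesis by simp
qed

subsection \<open>Types of index sequences\<close>

lemma cyc_in_range: "n > 0 \<Longrightarrow> cyc n k \<in> {1..n}"
  by (simp add: cyc_def Suc_leI)

text \<open>In the coordinate \<open>k - 1\<close>, which runs through \<open>0, ..., n - 1\<close>,
  the successor is addition of 1 modulo \<open>n\<close>.\<close>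

lemma cyc_funpow:
  assumes "k \<in> {1..n}"
  shows "(cyc n ^^ d) k = (k - 1 + d) mod n + 1"
proof (induction d)
  case (Suc d)
  then show ?case by (simp add: cyc_def[of n "Suc m" for m] mod_Suc_eq)
qed (use assms in auto)

lemma cyc_funpow_in_range: "k \<in> {1..n} \<Longrightarrow> (cyc n ^^ d) k \<in> {1..n}"
  by (simp add: cyc_funpow Suc_leI)

lemma cyc_inj_on: "inj_on (cyc n) {1..n}"
proof (rule inj_onI)
  fix a b assume "a \<in> {1..n}" "b \<in> {1..n}" "cyc n a = cyc n b"
  then show "a = b" unfolding cyc_def
    by (cases "a = n"; cases "b = n") auto
qed

lemma cyc_funpow_inj_on: "inj_on (cyc n ^^ d) {1..n}"
proof (induction d)
  case (Suc d)
  have "inj_on (cyc n) ((cyc n ^^ d) ` {1..n})"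
    by (rule inj_on_subset[OF cyc_inj_on]) (use cyc_funpow_in_range in blast)
  then show ?case using comp_inj_on[OF Suc] by (simp only: funpow.simps)
qed simp

lemma cyc_funpow_cancel:
  assumes "a \<in> {1..n}" "b \<in> {1..n}" "i \<le> j" "(cyc n ^^ i) a = (cyc n ^^ j) b"
  shows "a = (cyc n ^^ (j - i)) b"
proof -
  have "(cyc n ^^ j) b = (cyc n ^^ i) ((cyc n ^^ (j - i)) b)"
    using assms(3) by (metis comp_apply funpow_add le_add_diff_inverse)
  then show ?thesis
    using inj_onD[OF cyc_funpow_inj_on _ assms(1) cyc_funpow_in_range[OF assms(2)]] assms(4) by simp
qed

lemma cyc_reaches:
  assumes "a \<in> {1..n}" "b \<in> {1..n}"
  obtains d where "(cyc n ^^ d) a = b"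
proof
  \<comment> \<open>The witness is \<open>b + n - a\<close>: the summand \<open>n\<close> prevents
    truncation when \<open>b < a\<close> and disappears modulo \<open>n\<close>.\<close>
  have "a - 1 + (b + n - a) = (b - 1) + n" using assms by auto
  then have "(cyc n ^^ (b + n - a)) a = (b - 1) mod n + 1" using assms by (simp only: cyc_funpow mod_add_self2)
  also have "\<dots> = b" using assms(2) by (cases "b = n") (auto simp del: One_nat_def)
  finally show "(cyc n ^^ (b + n - a)) a = b" .
qed

lemma cyc_funpow_eq_self_iff:
  assumes "a \<in> {1..n}" "i < n" "j < n" "(cyc n ^^ i) a = (cyc n ^^ j) a"
  shows "i = j"
proof -
  have eq: "(a - 1 + i) mod n = (a - 1 + j) mod n" using assms by (simp add: cyc_funpow)
  \<comment> \<open>Natural subtraction truncates, so both differences \<open>i - j\<close> and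
    \<open>j - i\<close> are tested: each is a multiple of \<open>n\<close> smaller than
    \<open>n\<close>, hence zero.\<close>
  have "n dvd y - x" if "(a - 1 + x) mod n = (a - 1 + y) mod n" for x y
    using that mod_eq_dvd_iff_nat[of "a - 1 + x" "a - 1 + y" n] by (cases "x \<le> y") auto
  then have "n dvd i - j" "n dvd j - i" using eq by metis+
  then have "\<not> 0 < i - j" "\<not> 0 < j - i"
    using nat_dvd_not_less[of "i - j" n] nat_dvd_not_less[of "j - i" n] assms(2,3)
    by (metis less_imp_diff_less)+
  then show ?thesis by simp
qed

section \<open>Slots of a type and their placement on the cycle\<close>

lemma is_type_slot_ex:
  assumes "is_type u P" "i \<in> {1..u}"
  obtains p j where "p \<in> P" "j < length p" "i \<in> p ! j"
  using assms unfolding is_type_def by fast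

lemma is_type_part:
  assumes "is_type u P" "p \<in> P" "j < length p"
  shows "p ! j \<noteq> {}" "p ! j \<subseteq> {1..u}"
proof -
  have "p ! j \<in> set p" using assms(3) by simp
  then show "p ! j \<noteq> {}" "p ! j \<subseteq> {1..u}" using assms(1,2) unfolding is_type_def by auto
qed

lemma is_type_slot_unique:
  assumes "is_type u P" "p \<in> P" "j < length p" "i \<in> p ! j" "p' \<in> P" "j' < length p'" "i \<in> p' ! j'"
  shows "p = p'" "j = j'"
proof -
  have "i \<in> {1..u}" using is_type_part(2)[OF assms(1-3)] assms(4) by blast
  then have "\<exists>!x. case x of (p, j) \<Rightarrow> p \<in> P \<and> j < length p \<and> i \<in> p ! j"
    using assms(1) unfolding is_type_def by simp
  then have "(p, j) = (p', j')" using assms by auto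
  then show "p = p'" "j = j'" by auto
qed

lemma is_type_Nil_notin: "is_type u P \<Longrightarrow> p \<in> P \<Longrightarrow> p \<noteq> []"
  unfolding is_type_def by blast

text \<open>\<open>a p\<close> is the residue where the run of \<open>p\<close> starts. The offset
  \<open>j\<close> goes up to \<open>length p\<close> inclusive, so each run reserves the residue
  just behind it. Injectivity then makes the runs not only disjoint but separated by gaps, which is
  exactly what keeps them maximal.\<close>

definition spread :: "nat \<Rightarrow> nat set list set \<Rightarrow> (nat set list \<Rightarrow> nat) \<Rightarrow> bool" where
  "spread n P a \<longleftrightarrow> a ` P \<subseteq> {1..n} \<and>
     inj_on (\<lambda>(p, j). (cyc n ^^ j) (a p)) (SIGMA p:P. {..length p})"

definition placed :: "nat \<Rightarrow> nat set list set \<Rightarrow> (nat set list \<Rightarrow> nat) \<Rightarrow> (nat \<Rightarrow> nat) \<Rightarrow> bool" where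
  "placed n P a k \<longleftrightarrow> (\<forall>p\<in>P. \<forall>j<length p. \<forall>i\<in>p ! j. k i = (cyc n ^^ j) (a p))"

lemma spreadD:
  assumes "spread n P a" "p \<in> P" "p' \<in> P" "j \<le> length p" "j' \<le> length p'"
    "(cyc n ^^ j) (a p) = (cyc n ^^ j') (a p')"
  shows "p = p'" "j = j'"
proof -
  have "(p, j) = (p', j')"
    using assms unfolding spread_def
    by (intro inj_onD[of "\<lambda>(p, j). (cyc n ^^ j) (a p)" "SIGMA p:P. {..length p}"]) auto
  then show "p = p'" "j = j'" by auto
qed

text \<open>Walk backwards from \<open>v\<close> to the nearest residue \<open>w\<close> outside
  \<open>V\<close>. The run begins right after \<open>w\<close> and goes on until it first leaves
  \<open>V\<close>; both searches end because \<open>V\<close> misses some residue.\<close>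

lemma maximal_run_exists:
  assumes V: "V \<subseteq> {1..n}" "V \<noteq> {1..n}" and v: "v \<in> V"
  obtains a t j where "maximal_run n V a t" "j < t" "(cyc n ^^ j) a = v"
proof -
  obtain w0 where w0: "w0 \<in> {1..n}" "w0 \<notin> V" using V by blast
  let ?D = "\<lambda>d. \<exists>w\<in>{1..n} - V. (cyc n ^^ d) w = v"
  have "\<exists>d. ?D d" using w0 v V(1) cyc_reaches[of w0 n v] by blast
  then have D: "?D (LEAST d. ?D d)" by (rule LeastI_ex)
  define d where "d = (LEAST d. ?D d)"
  obtain w where w: "w \<in> {1..n}" "w \<notin> V" "(cyc n ^^ d) w = v" using D unfolding d_def by blast
  \<comment> \<open>A residue outside \<open>V\<close> strictly between \<open>w\<close> and
    \<open>v\<close> would reach \<open>v\<close> in fewer than \<open>d\<close> steps.\<close>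
  have min: "(cyc n ^^ j) w \<in> V" if "0 < j" "j \<le> d" for j
  proof (rule ccontr)
    assume "(cyc n ^^ j) w \<notin> V"
    moreover have "(cyc n ^^ (d - j)) ((cyc n ^^ j) w) = v"
      using w(3) that(2) by (metis comp_apply funpow_add le_add_diff_inverse2)
    ultimately have "?D (d - j)" using cyc_funpow_in_range[OF w(1)] by blast
    then have "d \<le> d - j" unfolding d_def by (rule Least_le)
    then show False using that by simp
  qed
  have d0: "d > 0" using w v by (cases d) auto
  define a where "a = cyc n w"
  have aw: "(cyc n ^^ j) a = (cyc n ^^ Suc j) w" for j
    unfolding a_def by (simp add: funpow_swap1)
  have aV: "(cyc n ^^ j) a \<in> V" if "j < d" for j using min[of "Suc j"] that aw by auto
  have a1: "a \<in> {1..n}" using aV[of 0] d0 V(1) by auto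
  let ?T = "\<lambda>t. (cyc n ^^ t) a \<notin> V"
  have "\<exists>t. ?T t" using cyc_reaches[OF a1 w(1)] w(2) by metis
  then have T: "?T (LEAST t. ?T t)" by (rule LeastI_ex)
  define t where "t = (LEAST t. ?T t)"
  have lt: "(cyc n ^^ j) a \<in> V" if "j < t" for j using that not_less_Least unfolding t_def by blast
  have dt: "d \<le> t" using T aV unfolding t_def by (meson not_less)
  \<comment> \<open>The only predecessor of \<open>a\<close> in the cycle is \<open>w\<close>, which
    lies outside \<open>V\<close>.\<close>
  have "cyc n b \<noteq> a" if "b \<in> V" for b
    using inj_onD[OF cyc_inj_on, of n b w] that V(1) w unfolding a_def by blast
  then have "maximal_run n V a t"
    unfolding maximal_run_def using T lt dt d0 unfolding t_def by auto
  moreover have "(cyc n ^^ (d - 1)) a = v" using aw[of "d - 1"] d0 w(3) by simp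
  ultimately show ?thesis using that dt d0 by (metis Suc_diff_1 Suc_le_lessD)
qed

lemma maximal_run_start_in: "maximal_run n V a t \<Longrightarrow> a \<in> V"
  unfolding maximal_run_def by (metis funpow_0)

text \<open>If two runs met at different offsets, cancelling the smaller offset would place the
  start of one run right after an element of \<open>V\<close>. The bounds \<open>j \<le> t\<close>
  and \<open>j' \<le> t'\<close> include the residue behind each run, as \<open>spread\<close>
  requires.\<close>

lemma maximal_run_unique:
  assumes V: "V \<subseteq> {1..n}" and r: "maximal_run n V a t" "maximal_run n V a' t'"
    and "j \<le> t" "j' \<le> t'" and eq: "(cyc n ^^ j) a = (cyc n ^^ j') a'"
  shows "a = a' \<and> t = t' \<and> j = j'"
proof -
  have *: "a = a' \<and> j = j'" if V: "V \<subseteq> {1..n}" and r: "maximal_run n V a t" "maximal_run n V a' t'"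
    and "j \<le> t" "j' \<le> t'" and eq: "(cyc n ^^ j) a = (cyc n ^^ j') a'" and le: "j \<le> j'" for a t a' t' j j'
  proof -
    have "a \<in> {1..n}" "a' \<in> {1..n}" using r V maximal_run_start_in by blast+
    then have a: "a = (cyc n ^^ (j' - j)) a'" using cyc_funpow_cancel eq le by blast
    show ?thesis
    proof (cases "j' - j")
      case 0
      then show ?thesis using a le by simp
    next
      case (Suc m)
      then have "cyc n ((cyc n ^^ m) a') = a" using a by simp
      moreover have "(cyc n ^^ m) a' \<in> V" using r(2) \<open>j' \<le> t'\<close> Suc unfolding maximal_run_def by auto
      ultimately show ?thesis using r(1) unfolding maximal_run_def by blast
    qed
  qed
  have aj: "a = a' \<and> j = j'"
  proof (cases "j \<le> j'")
    case True
    then show ?thesis using *[OF V r assms(4,5) eq] by blast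
  next
    case False
    then show ?thesis using *[OF V r(2,1) assms(5,4) eq[symmetric]] by simp
  qed
  \<comment> \<open>Two runs with the same start leave \<open>V\<close> at the same time.\<close>
  have "\<not> t < t'" "\<not> t' < t" using r aj unfolding maximal_run_def by blast+
  then show ?thesis using aj by simp
qed

text \<open>The starts of the maximal runs of the values of \<open>k\<close> serve as
  \<open>a\<close>; disjointness of the runs gives both \<open>spread\<close> and the uniqueness of
  slots.\<close>

lemma type_of_spread:
  assumes "u < n" and k: "k ` {1..u} \<subseteq> {1..n}"
  shows "is_type u (type_of n u k)"
    and "\<exists>a. spread n (type_of n u k) a \<and> placed n (type_of n u k) a k"
proof -
  define V where "V = k ` {1..u}"
  have V: "V \<subseteq> {1..n}" using k by (simp add: V_def)
  \<comment> \<open>Here \<open>u < n\<close> enters: some residue is not a value, so the values do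
    not fill the whole cycle.\<close>
  have "card V \<le> u" unfolding V_def using card_image_le[of "{1..u}" k] by simp
  then have Vn: "V \<noteq> {1..n}" using assms(1) by (metis card_atLeastAtMost diff_Suc_1 leD)
  define R where "R a t = map (\<lambda>j. {i\<in>{1..u}. k i = (cyc n ^^ j) a}) [0..<t]" for a t
  define P where "P = type_of n u k"
  have P: "P = {R a t | a t. maximal_run n V a t}"
    unfolding P_def type_of_def V_def R_def by simp
  define A where "A p = (SOME a. maximal_run n V a (length p) \<and> p = R a (length p))" for p
  have A: "maximal_run n V (A p) (length p)" "p = R (A p) (length p)" if "p \<in> P" for p
  proof -
    have "\<exists>a. maximal_run n V a (length p) \<and> p = R a (length p)" using that P by (auto simp: R_def)
    from someI_ex[OF this] show "maximal_run n V (A p) (length p)" "p = R (A p) (length p)"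
      unfolding A_def by auto
  qed
  have nth: "p ! j = {i\<in>{1..u}. k i = (cyc n ^^ j) (A p)}" if "p \<in> P" "j < length p" for p j
  proof -
    have "R (A p) (length p) ! j = {i\<in>{1..u}. k i = (cyc n ^^ j) (A p)}" using that by (simp add: R_def)
    then show ?thesis using A(2)[OF that(1)] by simp
  qed
  have spread: "spread n P A"
    unfolding spread_def
  proof (intro conjI inj_onI)
    show "A ` P \<subseteq> {1..n}" using A(1) maximal_run_start_in V by blast
    fix x y
    assume x: "x \<in> (SIGMA p:P. {..length p})" and y: "y \<in> (SIGMA p:P. {..length p})"
      and eq: "(case x of (p, j) \<Rightarrow> (cyc n ^^ j) (A p)) = (case y of (p, j) \<Rightarrow> (cyc n ^^ j) (A p))"
    obtain p j p' j' where xy: "x = (p, j)" "y = (p', j')" by (cases x, cases y)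
    then have m: "p \<in> P" "p' \<in> P" "j \<le> length p" "j' \<le> length p'" using x y by auto
    have "A p = A p' \<and> length p = length p' \<and> j = j'"
      using maximal_run_unique[OF V A(1)[OF m(1)] A(1)[OF m(2)] m(3,4)] eq xy by simp
    then show "x = y" using A(2)[OF m(1)] A(2)[OF m(2)] xy by simp
  qed
  moreover have placed: "placed n P A k" unfolding placed_def using nth by auto
  ultimately show "\<exists>a. spread n (type_of n u k) a \<and> placed n (type_of n u k) a k"
    unfolding P_def by blast
  show "is_type u (type_of n u k)"
    unfolding is_type_def P_def[symmetric]
  proof (intro conjI ballI)
    fix p assume p: "p \<in> P"
    show "p \<noteq> []" using A(1)[OF p] unfolding maximal_run_def by auto
    fix B assume "B \<in> set p"
    then obtain j where j: "j < length p" "B = p ! j" by (auto simp: in_set_conv_nth)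
    show "B \<subseteq> {1..u}" using nth[OF p j(1)] j(2) by auto
    have "(cyc n ^^ j) (A p) \<in> V" using A(1)[OF p] j(1) unfolding maximal_run_def by blast
    then show "B \<noteq> {}" using nth[OF p j(1)] j(2) unfolding V_def by fastforce
  next
    fix i assume i: "i \<in> {1..u}"
    then have "k i \<in> V" by (simp add: V_def)
    then obtain a t j where r: "maximal_run n V a t" "j < t" "(cyc n ^^ j) a = k i"
      using maximal_run_exists[OF V Vn] by metis
    show "\<exists>!(p, j). p \<in> P \<and> j < length p \<and> i \<in> p ! j"
    proof (rule ex1I[of _ "(R a t, j)"])
      show "case (R a t, j) of (p, j) \<Rightarrow> p \<in> P \<and> j < length p \<and> i \<in> p ! j"
        using r i P by (auto simp: R_def)
      fix y :: "nat set list \<times> nat" assume y: "case y of (p, j) \<Rightarrow> p \<in> P \<and> j < length p \<and> i \<in> p ! j"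
      obtain p' j' where y': "y = (p', j')" by (cases y)
      have pR: "R a t \<in> P" "j < length (R a t)" "i \<in> R a t ! j" using r i P by (auto simp: R_def)
      have p': "p' \<in> P" "j' < length p'" "i \<in> p' ! j'" using y y' by auto
      \<comment> \<open>Any slot of \<open>i\<close> describes the same residue \<open>k i\<close>,
        and \<open>spread\<close> allows only one description.\<close>
      have "(cyc n ^^ j') (A p') = (cyc n ^^ j) (A (R a t))"
        using nth[OF p'(1,2)] nth[OF pR(1,2)] p'(3) pR(3) by simp
      then show "y = (R a t, j)"
        using spreadD[OF spread p'(1) pR(1), of j' j] p'(2) pR(2) y' by simp
    qed
  qed
qed

text \<open>The converse of \<open>type_of_spread\<close>: the runs starting at the
  \<open>a p\<close> are maximal because of the gaps built into \<open>spread\<close>, and every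
  maximal run is one of them because the slots account for all values of \<open>k\<close>.\<close>

lemma type_of_placed:
  assumes P: "is_type u P" and a: "spread n P a" and k: "placed n P a k"
  shows "type_of n u k = P"
proof -
  define V where "V = k ` {1..u}"
  have kp: "k i = (cyc n ^^ j) (a p)" if "p \<in> P" "j < length p" "i \<in> p ! j" for p j i
    using k that unfolding placed_def by blast
  have VI: "(cyc n ^^ j) (a p) \<in> V" if "p \<in> P" "j < length p" for p j
  proof -
    from is_type_part[OF P that] have "\<exists>i\<in>{1..u}. i \<in> p ! j" by blast
    then show ?thesis unfolding V_def using kp[OF that] by (metis imageI)
  qed
  have VE: "\<exists>p j. p \<in> P \<and> j < length p \<and> v = (cyc n ^^ j) (a p)" if "v \<in> V" for v
  proof -
    from that obtain i where i: "i \<in> {1..u}" "v = k i" unfolding V_def by blast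
    obtain p j where "p \<in> P" "j < length p" "i \<in> p ! j" using is_type_slot_ex[OF P i(1)] .
    then show ?thesis using kp i by blast
  qed
  define R where "R b t = map (\<lambda>j. {i\<in>{1..u}. k i = (cyc n ^^ j) b}) [0..<t]" for b t
  have Rp: "R (a p) (length p) = p" if p: "p \<in> P" for p
  proof (rule nth_equalityI)
    fix j assume "j < length (R (a p) (length p))"
    then have j: "j < length p" by (simp add: R_def)
    have "i \<in> p ! j" if i: "i \<in> {1..u}" "k i = (cyc n ^^ j) (a p)" for i
    proof -
      obtain p' j' where s: "p' \<in> P" "j' < length p'" "i \<in> p' ! j'" using is_type_slot_ex[OF P i(1)] .
      then have "(cyc n ^^ j') (a p') = (cyc n ^^ j) (a p)" using kp[OF s] i(2) by simp
      then show ?thesis using spreadD[OF a s(1) p, of j' j] s j by simp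
    qed
    moreover have "i \<in> {1..u}" if "i \<in> p ! j" for i using is_type_part(2)[OF P p j] that by blast
    moreover have "k i = (cyc n ^^ j) (a p)" if "i \<in> p ! j" for i by (rule kp[OF p j that])
    ultimately have "{i\<in>{1..u}. k i = (cyc n ^^ j) (a p)} = p ! j" by blast
    then show "R (a p) (length p) ! j = p ! j" using j by (simp add: R_def)
  qed (simp add: R_def)
  have run: "maximal_run n V (a p) (length p)" if p: "p \<in> P" for p
    unfolding maximal_run_def
  proof (intro conjI ballI allI impI)
    show "0 < length p" using is_type_Nil_notin[OF P p] by simp
    show "(cyc n ^^ j) (a p) \<in> V" if "j < length p" for j using VI p that by blast
    \<comment> \<open>The residue behind the run has offset \<open>length p\<close>, which
      \<open>spread\<close> keeps apart from all slots.\<close>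
    show "(cyc n ^^ length p) (a p) \<notin> V"
    proof
      assume "(cyc n ^^ length p) (a p) \<in> V"
      then obtain p' j' where s: "p' \<in> P" "j' < length p'"
        "(cyc n ^^ length p) (a p) = (cyc n ^^ j') (a p')" using VE by blast
      then show False using spreadD[OF a p s(1) _ _ s(3)] by auto
    qed
    fix b assume "b \<in> V"
    then obtain p' j' where s: "p' \<in> P" "j' < length p'" "b = (cyc n ^^ j') (a p')" using VE by blast
    then show "cyc n b \<noteq> a p" using spreadD(2)[OF a s(1) p, of "Suc j'" 0] by auto
  qed
  have "\<exists>p\<in>P. b = a p \<and> t = length p" if r: "maximal_run n V b t" for b t
  proof -
    obtain p j where s: "p \<in> P" "j < length p" "b = (cyc n ^^ j) (a p)"
      using VE[OF maximal_run_start_in[OF r]] by blast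
    \<comment> \<open>A slot of positive offset has its predecessor in \<open>V\<close>, so no
      maximal run starts there.\<close>
    have "j = 0"
    proof (cases j)
      case (Suc m)
      then have "cyc n ((cyc n ^^ m) (a p)) = b" "(cyc n ^^ m) (a p) \<in> V" using s VI by auto
      then show ?thesis using r unfolding maximal_run_def by blast
    qed simp
    then have b: "b = a p" using s by simp
    have "\<not> t < length p" "\<not> length p < t"
      using r run[OF s(1)] b unfolding maximal_run_def by blast+
    then show ?thesis using s(1) b by auto
  qed
  then have "type_of n u k = (\<lambda>p. R (a p) (length p)) ` P"
    unfolding type_of_def V_def[symmetric] R_def[symmetric] using run by blast
  then show ?thesis using Rp by simp
qed

section \<open>Weights, and finiteness of the set of types\<close>

lemma weight_eq_sum:
  assumes "is_type u P" "p \<in> P"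
  shows "weight p = (\<Sum>j<length p. card (p ! j))"
proof -
  have "set p = (!) p ` {..<length p}" by (auto simp: set_conv_nth)
  then have "\<Union>(set p) = (\<Union>j<length p. p ! j)" by simp
  moreover have "card (\<Union>j<length p. p ! j) = (\<Sum>j<length p. card (p ! j))"
  proof (rule card_UN_disjoint)
    show "\<forall>j\<in>{..<length p}. finite (p ! j)"
      using is_type_part[OF assms] finite_subset by blast
    show "\<forall>i\<in>{..<length p}. \<forall>j\<in>{..<length p}. i \<noteq> j \<longrightarrow> p ! i \<inter> p ! j = {}"
      using is_type_slot_unique(2)[OF assms(1,2) _ _ assms(2)] by blast
  qed simp
  ultimately show ?thesis unfolding weight_def by simp
qed

lemma length_le_weight:
  assumes "is_type u P" "p \<in> P"
  shows "length p \<le> weight p"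
proof -
  have "1 \<le> card (p ! j)" if "j < length p" for j
    using is_type_part[OF assms that] finite_subset[of "p ! j" "{1..u}"] by (simp add: card_gt_0_iff Suc_le_eq)
  then have "(\<Sum>j<length p. 1) \<le> (\<Sum>j<length p. card (p ! j))" by (intro sum_mono) auto
  then show ?thesis using weight_eq_sum[OF assms] by simp
qed

lemma is_type_subset: "is_type u P \<Longrightarrow> p \<in> P \<Longrightarrow> \<Union>(set p) \<subseteq> {1..u}"
  unfolding is_type_def by blast

lemma length_le_size:
  assumes "is_type u P" "p \<in> P"
  shows "length p \<le> u"
  using length_le_weight[OF assms] card_mono[OF _ is_type_subset[OF assms]]
  unfolding weight_def by simp

lemma is_type_in_lists:
  assumes "is_type u P"
  shows "P \<subseteq> {p. set p \<subseteq> Pow {1..u} \<and> length p \<le> u}"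
  using length_le_size[OF assms] assms unfolding is_type_def by blast

lemma finite_is_type: "finite {P. is_type u P}"
proof (rule finite_subset)
  show "finite (Pow {p. set p \<subseteq> Pow {1..u} \<and> length p \<le> u})"
    using finite_lists_length_le[of "Pow {1..u}" u] by simp
qed (use is_type_in_lists in blast)

lemma is_type_finite: "is_type u P \<Longrightarrow> finite P"
  using is_type_in_lists finite_lists_length_le[of "Pow {1..u}" u] finite_subset by fastforce

text \<open>The members have disjoint supports covering \<open>{1..u}\<close>. Together with lower
  bounds on the weights this limits the number of members.\<close>

lemma sum_weight:
  assumes P: "is_type u P"
  shows "(\<Sum>p\<in>P. weight p) = u"
proof -
  have "(\<Union>p\<in>P. \<Union>(set p)) = {1..u}"
  proof
    show "{1..u} \<subseteq> (\<Union>p\<in>P. \<Union>(set p))"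
    proof
      fix i assume "i \<in> {1..u}"
      then obtain p j where "p \<in> P" "j < length p" "i \<in> p ! j" using is_type_slot_ex[OF P] by blast
      then have "p ! j \<in> set p" by simp
      then show "i \<in> (\<Union>p\<in>P. \<Union>(set p))" using \<open>p \<in> P\<close> \<open>i \<in> p ! j\<close> by blast
    qed
  qed (use is_type_subset[OF P] in blast)
  moreover have "card (\<Union>p\<in>P. \<Union>(set p)) = (\<Sum>p\<in>P. card (\<Union>(set p)))"
  proof (rule card_UN_disjoint[OF is_type_finite[OF P]])
    show "\<forall>p\<in>P. finite (\<Union>(set p))" using is_type_subset[OF P] finite_subset by blast
    show "\<forall>p\<in>P. \<forall>p'\<in>P. p \<noteq> p' \<longrightarrow> \<Union>(set p) \<inter> \<Union>(set p') = {}"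
    proof (intro ballI impI equals0I)
      fix p p' i assume *: "p \<in> P" "p' \<in> P" "p \<noteq> p'" "i \<in> \<Union>(set p) \<inter> \<Union>(set p')"
      then obtain j j' where "j < length p" "i \<in> p ! j" "j' < length p'" "i \<in> p' ! j'"
        by (auto simp: in_set_conv_nth)
      then show False using is_type_slot_unique(1)[OF P] * by blast
    qed
  qed
  ultimately show ?thesis unfolding weight_def by simp
qed

subsection \<open>Counting the index sequences of a given type\<close>

text \<open>The sequence with prescribed run starts. \<open>SOME\<close> selects the slot of
  \<open>i\<close>, unique when \<open>P\<close> is a type, and the restriction makes the result
  extensional so that sequences can be counted in a \<open>PiE\<close> set.\<close>

definition place :: "nat \<Rightarrow> nat \<Rightarrow> nat set list set \<Rightarrow> (nat set list \<Rightarrow> nat) \<Rightarrow> nat \<Rightarrow> nat" where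
  "place n u P a = (\<lambda>i\<in>{1..u}.
     case SOME (p, j). p \<in> P \<and> j < length p \<and> i \<in> p ! j of (p, j) \<Rightarrow> (cyc n ^^ j) (a p))"

lemma place_undefined: "i \<notin> {1..u} \<Longrightarrow> place n u P a i = undefined"
  unfolding place_def by (simp only: restrict_apply if_False)

lemma place_eq:
  assumes P: "is_type u P" and s: "p \<in> P" "j < length p" "i \<in> p ! j"
  shows "place n u P a i = (cyc n ^^ j) (a p)"
proof -
  have i: "i \<in> {1..u}" using is_type_part(2)[OF P s(1,2)] s(3) by blast
  have "(SOME x. case x of (p, j) \<Rightarrow> p \<in> P \<and> j < length p \<and> i \<in> p ! j) = (p, j)"
  proof (rule some_equality)
    fix x assume "case x of (p, j) \<Rightarrow> p \<in> P \<and> j < length p \<and> i \<in> p ! j"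
    then show "x = (p, j)" using is_type_slot_unique[OF P _ _ _ s] by (cases x) auto
  qed (use s in simp)
  then show ?thesis unfolding place_def using i by simp
qed

lemma placed_place: "is_type u P \<Longrightarrow> placed n P a (place n u P a)"
  unfolding placed_def by (simp add: place_eq)

lemma place_in_range:
  assumes P: "is_type u P" and a: "a ` P \<subseteq> {1..n}"
  shows "place n u P a \<in> {1..u} \<rightarrow>\<^sub>E {1..n}"
proof
  fix i assume "i \<in> {1..u}"
  then obtain p j where s: "p \<in> P" "j < length p" "i \<in> p ! j" using is_type_slot_ex[OF P] by blast
  have "a p \<in> {1..n}" using a s(1) by blast
  then show "place n u P a i \<in> {1..n}" using cyc_funpow_in_range by (simp only: place_eq[OF P s])
qed (rule place_undefined)

lemma placed_eq_place:
  assumes P: "is_type u P" and k: "k \<in> extensional {1..u}" "placed n P a k"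
  shows "k = place n u P a"
proof
  fix i
  show "k i = place n u P a i"
  proof (cases "i \<in> {1..u}")
    case True
    then obtain p j where s: "p \<in> P" "j < length p" "i \<in> p ! j" using is_type_slot_ex[OF P] by blast
    then show ?thesis using k(2) place_eq[OF P s] unfolding placed_def by simp
  next
    case False
    then show ?thesis using extensional_arb[OF k(1)] place_undefined by metis
  qed
qed

definition of_type :: "nat \<Rightarrow> nat \<Rightarrow> nat set list set \<Rightarrow> (nat \<Rightarrow> nat) set" where
  "of_type n u P = {k \<in> {1..u} \<rightarrow>\<^sub>E {1..n}. type_of n u k = P}"

text \<open>Sequences of type \<open>P\<close> are parametrised by the starts of their runs, which
  reduces counting them to counting the choices of starts that satisfy
  \<open>spread\<close>.\<close>

lemma of_type_eq_image:
  assumes P: "is_type u P" and "u < n"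
  shows "of_type n u P = place n u P ` {a \<in> P \<rightarrow>\<^sub>E {1..n}. spread n P a}"
proof (intro equalityI subsetI)
  fix k assume "k \<in> of_type n u P"
  then have k: "k \<in> {1..u} \<rightarrow>\<^sub>E {1..n}" "type_of n u k = P" by (auto simp: of_type_def)
  have "k ` {1..u} \<subseteq> {1..n}" using k(1) by blast
  then obtain a where a: "spread n P a" "placed n P a k" using type_of_spread(2)[OF assms(2)] k(2) by metis
  \<comment> \<open>\<open>spread\<close> and \<open>placed\<close> see \<open>a\<close> only on
    \<open>P\<close>, so \<open>a\<close> may be replaced by its extensional restriction.\<close>
  define b where "b = restrict a P"
  have "(\<lambda>(p, j). (cyc n ^^ j) (b p)) x = (\<lambda>(p, j). (cyc n ^^ j) (a p)) x"
    if "x \<in> (SIGMA p:P. {..length p})" for x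
    using that by (auto simp: b_def)
  then have "inj_on (\<lambda>(p, j). (cyc n ^^ j) (b p)) (SIGMA p:P. {..length p}) =
    inj_on (\<lambda>(p, j). (cyc n ^^ j) (a p)) (SIGMA p:P. {..length p})"
    by (rule inj_on_cong)
  then have "spread n P b" using a(1) unfolding spread_def by (auto simp: b_def)
  moreover have "b \<in> P \<rightarrow>\<^sub>E {1..n}" using a(1) unfolding spread_def b_def by auto
  moreover have "placed n P b k" using a(2) unfolding placed_def b_def by simp
  then have "k = place n u P b" using placed_eq_place[OF P] k(1) by (simp add: PiE_def)
  ultimately show "k \<in> place n u P ` {a \<in> P \<rightarrow>\<^sub>E {1..n}. spread n P a}" by blast
next
  fix k assume "k \<in> place n u P ` {a \<in> P \<rightarrow>\<^sub>E {1..n}. spread n P a}"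
  then obtain a where a: "spread n P a" "k = place n u P a" by blast
  then have "k \<in> {1..u} \<rightarrow>\<^sub>E {1..n}" using place_in_range[OF P] unfolding spread_def by simp
  then show "k \<in> of_type n u P"
    using type_of_placed[OF P a(1) placed_place[OF P]] a(2) by (simp add: of_type_def)
qed

text \<open>The start \<open>a p\<close> can be read off at any index in the first subset of
  \<open>p\<close>, which is nonempty.\<close>

lemma inj_on_place:
  assumes P: "is_type u P"
  shows "inj_on (place n u P) (P \<rightarrow>\<^sub>E {1..n})"
proof (rule inj_onI)
  fix a b assume ab: "a \<in> P \<rightarrow>\<^sub>E {1..n}" "b \<in> P \<rightarrow>\<^sub>E {1..n}" and eq: "place n u P a = place n u P b"
  show "a = b"
  proof (rule PiE_ext[OF ab])
    fix p assume p: "p \<in> P"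
    have l: "0 < length p" using is_type_Nil_notin[OF P p] by simp
    obtain i where "i \<in> p ! 0" using is_type_part(1)[OF P p l] by blast
    then show "a p = b p" using place_eq[OF P p l] eq by (metis funpow_0)
  qed
qed

lemma card_of_type_le:
  assumes P: "is_type u P" and "u < n"
  shows "card (of_type n u P) \<le> n ^ card P"
proof -
  have fin: "finite P" by (rule is_type_finite[OF P])
  have "card (of_type n u P) \<le> card {a \<in> P \<rightarrow>\<^sub>E {1..n}. spread n P a}"
    unfolding of_type_eq_image[OF assms] using fin by (intro card_image_le) (simp add: finite_PiE)
  also have "\<dots> \<le> card (P \<rightarrow>\<^sub>E {1..n})" using fin by (intro card_mono) (auto simp: finite_PiE)
  also have "\<dots> = n ^ card P" using fin by (simp add: card_PiE)
  finally show ?thesis .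
qed

text \<open>A prescribed coincidence determines \<open>a p\<close> from \<open>a p'\<close>, so one
  of the \<open>card P\<close> free choices is lost.\<close>

lemma card_colliding_le:
  assumes "finite P" "p \<in> P" "p' \<in> P" "p \<noteq> p'"
  shows "n * card {a \<in> P \<rightarrow>\<^sub>E {1..n}. (cyc n ^^ i) (a p) = (cyc n ^^ j) (a p')} \<le> n ^ card P"
proof -
  let ?B = "{a \<in> P \<rightarrow>\<^sub>E {1..n}. (cyc n ^^ i) (a p) = (cyc n ^^ j) (a p')}"
  have "inj_on (\<lambda>a. restrict a (P - {p})) ?B"
  proof (rule inj_onI)
    fix a b assume a: "a \<in> ?B" and b: "b \<in> ?B" and eq: "restrict a (P - {p}) = restrict b (P - {p})"
    have *: "a q = b q" if "q \<in> P - {p}" for q using fun_cong[OF eq, of q] that by simp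
    then have "a p' = b p'" using assms by auto
    then have "(cyc n ^^ i) (a p) = (cyc n ^^ i) (b p)" using a b by simp
    moreover have "a p \<in> {1..n}" "b p \<in> {1..n}" using a b assms(2) by blast+
    ultimately have "a p = b p" using inj_onD[OF cyc_funpow_inj_on] by blast
    then have "a q = b q" if "q \<in> P" for q using * that by (cases "q = p") auto
    moreover have "a \<in> P \<rightarrow>\<^sub>E {1..n}" "b \<in> P \<rightarrow>\<^sub>E {1..n}" using a b by auto
    ultimately show "a = b" by (intro PiE_ext)
  qed
  moreover have "(\<lambda>a. restrict a (P - {p})) ` ?B \<subseteq> (P - {p}) \<rightarrow>\<^sub>E {1..n}"
    by (intro image_subsetI) (simp add: restrict_PiE_iff PiE_iff)
  ultimately have "card ?B \<le> card ((P - {p}) \<rightarrow>\<^sub>E {1..n})"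
    using assms(1) by (intro card_inj_on_le) (auto simp: finite_PiE)
  then have "n * card ?B \<le> n * n ^ card (P - {p})" using assms(1) by (simp add: card_PiE)
  also have "\<dots> = n ^ card P"
    using card.remove[OF assms(1,2)] by simp
  finally show ?thesis .
qed

text \<open>A choice of starts that is not spread has a collision, and the union bound over pairs of
  offsets applies. The deficit is multiplied by \<open>n\<close> to stay within the natural numbers;
  the bounding constant depends on \<open>P\<close> only.\<close>

lemma card_of_type_ge:
  assumes P: "is_type u P" and n: "u < n"
  shows "n * (n ^ card P - card (of_type n u P)) \<le> card ((SIGMA p:P. {..length p}) \<times> (SIGMA p:P. {..length p})) * n ^ card P"
proof -
  let ?I = "SIGMA p:P. {..length p}"
  have fin: "finite P" by (rule is_type_finite[OF P])
  have finI: "finite ?I" using fin by simp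
  let ?F = "P \<rightarrow>\<^sub>E {1..n}"
  have finF: "finite ?F" using fin by (simp add: finite_PiE)
  define B where "B = (\<lambda>((p, i), (p', j)). if p = p' then {} else
    {a \<in> ?F. (cyc n ^^ i) (a p) = (cyc n ^^ j) (a p')})"
  have B: "n * card (B x) \<le> n ^ card P" if "x \<in> ?I \<times> ?I" for x
    using that card_colliding_le[OF fin] by (auto simp: B_def split: prod.splits)
  have "?F - {a \<in> ?F. spread n P a} \<subseteq> (\<Union>x\<in>?I \<times> ?I. B x)"
  proof
    fix a assume a: "a \<in> ?F - {a \<in> ?F. spread n P a}"
    then have r: "a p \<in> {1..n}" if "p \<in> P" for p using that by blast
    have "a ` P \<subseteq> {1..n}" using r by blast
    then have "\<not> inj_on (\<lambda>(p, j). (cyc n ^^ j) (a p)) ?I" using a unfolding spread_def by blast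
    then obtain x y where xy: "x \<in> ?I" "y \<in> ?I" "x \<noteq> y"
      "(case x of (p, j) \<Rightarrow> (cyc n ^^ j) (a p)) = (case y of (p, j) \<Rightarrow> (cyc n ^^ j) (a p))"
      unfolding inj_on_def by blast
    obtain p i p' j where e: "x = (p, i)" "y = (p', j)" by (cases x, cases y)
    have m: "p \<in> P" "p' \<in> P" "i \<le> length p" "j \<le> length p'"
      "(cyc n ^^ i) (a p) = (cyc n ^^ j) (a p')" using xy e by auto
    \<comment> \<open>Offsets are at most \<open>u < n\<close>, and the first \<open>n\<close>
      iterates of a residue are distinct. A collision therefore involves two different members,
      which is why \<open>B\<close> may be empty for \<open>p = p'\<close>.\<close>
    have "i < n" "j < n" using m n length_le_size[OF P m(1)] length_le_size[OF P m(2)] by auto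
    then have "p \<noteq> p'" using cyc_funpow_eq_self_iff[OF r[OF m(1)]] m xy(3) e by auto
    then have "a \<in> B (x, y)" using m a e by (simp add: B_def)
    then show "a \<in> (\<Union>x\<in>?I \<times> ?I. B x)" using xy by blast
  qed
  then have "card (?F - {a \<in> ?F. spread n P a}) \<le> card (\<Union>x\<in>?I \<times> ?I. B x)"
    using finI finF by (intro card_mono) (auto simp: B_def)
  also have "\<dots> \<le> (\<Sum>x\<in>?I \<times> ?I. card (B x))" using finI by (intro card_UN_le) simp
  finally have "n * card (?F - {a \<in> ?F. spread n P a}) \<le> (\<Sum>x\<in>?I \<times> ?I. n * card (B x))"
    by (simp add: sum_distrib_left[symmetric])
  also have "\<dots> \<le> (\<Sum>x\<in>?I \<times> ?I. n ^ card P)" using B by (rule sum_mono)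
  finally have "n * card (?F - {a \<in> ?F. spread n P a}) \<le> card (?I \<times> ?I) * n ^ card P" by simp
  moreover have "card (of_type n u P) = card {a \<in> ?F. spread n P a}"
    unfolding of_type_eq_image[OF assms]
    by (rule card_image, rule inj_on_subset[OF inj_on_place[OF P]]) blast
  moreover have "card (?F - {a \<in> ?F. spread n P a}) = n ^ card P - card {a \<in> ?F. spread n P a}"
    using finF fin by (subst card_Diff_subset) (auto simp: card_PiE)
  ultimately show ?thesis by simp
qed

lemma card_of_type_asymptotics:
  assumes P: "is_type u P"
  shows "(\<lambda>n. real (card (of_type n u P)) / real n ^ card P) \<longlonglongrightarrow> 1"
proof -
  define C where "C = real (card ((SIGMA p:P. {..length p}) \<times> (SIGMA p:P. {..length p})))"
  have "(\<lambda>n. 1 - C / real n) \<longlonglongrightarrow> 1 - 0"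
    by (intro tendsto_diff tendsto_const lim_const_over_n)
  then have lim: "(\<lambda>n. 1 - C / real n) \<longlonglongrightarrow> 1" by simp
  show ?thesis
  proof (rule tendsto_sandwich[OF _ _ lim tendsto_const])
    show "\<forall>\<^sub>F n in sequentially. 1 - C / real n \<le> real (card (of_type n u P)) / real n ^ card P"
      using eventually_gt_at_top[of u]
    proof eventually_elim
      case (elim n)
      have le: "card (of_type n u P) \<le> n ^ card P" by (rule card_of_type_le[OF P elim])
      have "real (n * (n ^ card P - card (of_type n u P))) \<le> C * real (n ^ card P)"
        using card_of_type_ge[OF P elim] unfolding C_def by (simp only: of_nat_mult[symmetric] of_nat_le_iff)
      then have "real n * (real n ^ card P - real (card (of_type n u P))) \<le> C * real n ^ card P"
        using le by (simp add: of_nat_diff)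
      moreover have "real n > 0" "real n ^ card P > 0" using elim by auto
      ultimately show ?case by (simp add: field_simps)
    qed
    show "\<forall>\<^sub>F n in sequentially. real (card (of_type n u P)) / real n ^ card P \<le> 1"
      using eventually_gt_at_top[of u]
    proof eventually_elim
      case (elim n)
      have "real (card (of_type n u P)) \<le> real (n ^ card P)"
        using card_of_type_le[OF P elim] by (simp only: of_nat_le_iff)
      then show ?case using elim by simp
    qed
  qed
qed

subsection \<open>Moments as sums over index sequences\<close>

abbreviation perms :: "nat \<Rightarrow> (nat \<Rightarrow> nat) set" where
  "perms n \<equiv> {\<sigma>. \<sigma> permutes {1..2*n}}"

text \<open>The sign \<open>eps\<close> factors into \<open>signA\<close>, depending on the x-order
  only, and \<open>signB\<close>, depending on the y-order only. A change of \<open>\<sigma>\<close>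
  or \<open>\<pi>\<close> alone thus affects a single factor.\<close>

definition signA :: "nat \<Rightarrow> (nat \<Rightarrow> nat) \<Rightarrow> nat \<Rightarrow> nat \<Rightarrow> int" where
  "signA n \<sigma> k l = (if \<sigma> k < \<sigma> (n + l) \<and> \<sigma> (n + l) < \<sigma> (cyc n k) then 1
     else if \<sigma> (cyc n k) < \<sigma> (n + l) \<and> \<sigma> (n + l) < \<sigma> k then -1 else 0)"

definition signB :: "nat \<Rightarrow> (nat \<Rightarrow> nat) \<Rightarrow> nat \<Rightarrow> nat \<Rightarrow> int" where
  "signB n \<pi> k l = (if \<pi> (n + cyc n l) < \<pi> (cyc n k) \<and> \<pi> (cyc n k) < \<pi> (n + l) then 1
     else if \<pi> (n + l) < \<pi> (cyc n k) \<and> \<pi> (cyc n k) < \<pi> (n + cyc n l) then -1 else 0)"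

lemma eps_perm_less:
  "eps n (perm_less n \<sigma>) (perm_less n \<pi>) k l = signA n \<sigma> k l * signB n \<pi> k l"
  unfolding eps_def condA_def condB_def signA_def signB_def perm_less_def by auto

text \<open>The expectation of the product of signs along \<open>k\<close> and \<open>l\<close>,
  before division by the number of pairs of permutations; this keeps it an integer.\<close>

definition sign_sum :: "nat \<Rightarrow> nat \<Rightarrow> (nat \<Rightarrow> nat) \<Rightarrow> (nat \<Rightarrow> nat) \<Rightarrow> int" where
  "sign_sum n u k l = (\<Sum>\<sigma>\<in>perms n. \<Sum>\<pi>\<in>perms n. \<Prod>i=1..u. signA n \<sigma> (k i) (l i) * signB n \<pi> (k i) (l i))"

lemma finite_perms: "finite (perms n)"
  by (simp add: finite_permutations)

lemma card_perms: "card (perms n) = fact (2 * n)"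
  by (rule card_permutations) auto

lemma lk_power:
  "lk n \<sigma> \<pi> ^ u = (\<Sum>k\<in>{1..u} \<rightarrow>\<^sub>E {1..n}. \<Sum>l\<in>{1..u} \<rightarrow>\<^sub>E {1..n}.
     \<Prod>i=1..u. signA n \<sigma> (k i) (l i) * signB n \<pi> (k i) (l i))"
proof -
  have "lk n \<sigma> \<pi> ^ u = (\<Prod>i=1..u. \<Sum>k=1..n. \<Sum>l=1..n. signA n \<sigma> k l * signB n \<pi> k l)"
    by (simp add: lk_eq_sum_eps eps_perm_less)
  also have "\<dots> = (\<Sum>k\<in>{1..u} \<rightarrow>\<^sub>E {1..n}. \<Prod>i=1..u. \<Sum>l=1..n. signA n \<sigma> (k i) l * signB n \<pi> (k i) l)"
    by (rule prod_sum_PiE) auto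
  also have "\<dots> = (\<Sum>k\<in>{1..u} \<rightarrow>\<^sub>E {1..n}. \<Sum>l\<in>{1..u} \<rightarrow>\<^sub>E {1..n}.
     \<Prod>i=1..u. signA n \<sigma> (k i) (l i) * signB n \<pi> (k i) (l i))"
    by (intro sum.cong refl prod_sum_PiE) auto
  finally show ?thesis .
qed

lemma lk_moment_eq_average:
  "lk_moment u n = real_of_int (\<Sum>\<sigma>\<in>perms n. \<Sum>\<pi>\<in>perms n. lk n \<sigma> \<pi> ^ u) / (fact (2 * n))\<^sup>2"
proof -
  have ne: "perms n \<noteq> {}" using permutes_id by blast
  have sub: "set_pmf (random_grid n) = perms n \<times> perms n"
    unfolding random_grid_def Let_def using finite_perms[of n] ne by simp
  have "lk_moment u n =
    (\<Sum>x\<in>perms n \<times> perms n. (case x of (\<sigma>, \<pi>) \<Rightarrow> real_of_int (lk n \<sigma> \<pi>) ^ u) * pmf (random_grid n) x)"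
    unfolding lk_moment_def
    by (rule integral_measure_pmf_real) (use finite_perms[of n] sub in auto)
  also have "\<dots> = (\<Sum>x\<in>perms n \<times> perms n.
    case x of (\<sigma>, \<pi>) \<Rightarrow> real_of_int (lk n \<sigma> \<pi> ^ u) / (fact (2 * n))\<^sup>2)"
  proof (rule sum.cong[OF refl])
    fix x assume "x \<in> perms n \<times> perms n"
    then obtain \<sigma> \<pi> where x: "x = (\<sigma>, \<pi>)" "\<sigma> \<in> perms n" "\<pi> \<in> perms n" by blast
    have "pmf (random_grid n) x = 1 / fact (2 * n) * (1 / fact (2 * n))"
      unfolding random_grid_def Let_def x(1) pmf_pair
      using pmf_of_set[OF ne finite_perms] x(2,3) card_perms[of n] by simp
    then show "(case x of (\<sigma>, \<pi>) \<Rightarrow> real_of_int (lk n \<sigma> \<pi>) ^ u) * pmf (random_grid n) x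
      = (case x of (\<sigma>, \<pi>) \<Rightarrow> real_of_int (lk n \<sigma> \<pi> ^ u) / (fact (2 * n))\<^sup>2)"
      using x(1) by (simp add: power2_eq_square)
  qed
  also have "\<dots> = real_of_int (\<Sum>\<sigma>\<in>perms n. \<Sum>\<pi>\<in>perms n. lk n \<sigma> \<pi> ^ u) / (fact (2 * n))\<^sup>2"
    unfolding sum.cartesian_product[symmetric] by (simp add: sum_divide_distrib)
  finally show ?thesis .
qed

lemma lk_moment_eq_sign_sum:
  "lk_moment u n = (\<Sum>k\<in>{1..u} \<rightarrow>\<^sub>E {1..n}. \<Sum>l\<in>{1..u} \<rightarrow>\<^sub>E {1..n}.
     real_of_int (sign_sum n u k l) / (fact (2 * n))\<^sup>2)"
proof -
  let ?I = "{1..u} \<rightarrow>\<^sub>E {1..n}"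
  define F where "F \<sigma> \<pi> k l = (\<Prod>i=1..u. signA n \<sigma> (k i) (l i) * signB n \<pi> (k i) (l i))" for \<sigma> \<pi> k l
  have "(\<Sum>\<sigma>\<in>perms n. \<Sum>\<pi>\<in>perms n. lk n \<sigma> \<pi> ^ u) =
    (\<Sum>\<sigma>\<in>perms n. \<Sum>\<pi>\<in>perms n. \<Sum>k\<in>?I. \<Sum>l\<in>?I. F \<sigma> \<pi> k l)"
    unfolding F_def lk_power ..
  also have "\<dots> = (\<Sum>\<sigma>\<in>perms n. \<Sum>k\<in>?I. \<Sum>\<pi>\<in>perms n. \<Sum>l\<in>?I. F \<sigma> \<pi> k l)"
    by (intro sum.cong refl sum.swap)
  also have "\<dots> = (\<Sum>k\<in>?I. \<Sum>\<sigma>\<in>perms n. \<Sum>\<pi>\<in>perms n. \<Sum>l\<in>?I. F \<sigma> \<pi> k l)"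
    by (rule sum.swap)
  also have "\<dots> = (\<Sum>k\<in>?I. \<Sum>\<sigma>\<in>perms n. \<Sum>l\<in>?I. \<Sum>\<pi>\<in>perms n. F \<sigma> \<pi> k l)"
    by (intro sum.cong refl sum.swap)
  also have "\<dots> = (\<Sum>k\<in>?I. \<Sum>l\<in>?I. \<Sum>\<sigma>\<in>perms n. \<Sum>\<pi>\<in>perms n. F \<sigma> \<pi> k l)"
    by (intro sum.cong refl sum.swap)
  finally show ?thesis
    unfolding lk_moment_eq_average sign_sum_def F_def by (simp add: sum_divide_distrib)
qed

lemma abs_signA_le: "\<bar>signA n \<sigma> k l\<bar> \<le> 1" and abs_signB_le: "\<bar>signB n \<pi> k l\<bar> \<le> 1"
  by (simp_all add: signA_def signB_def)

lemma abs_sign_sum_le: "\<bar>real_of_int (sign_sum n u k l) / (fact (2 * n))\<^sup>2\<bar> \<le> 1"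
proof -
  have p: "\<bar>\<Prod>i=1..u. signA n \<sigma> (k i) (l i) * signB n \<pi> (k i) (l i)\<bar> \<le> 1" for \<sigma> \<pi>
    unfolding abs_prod
    by (rule prod_le_1) (simp add: abs_mult abs_signA_le abs_signB_le mult_le_one)
  have "\<bar>sign_sum n u k l\<bar> \<le> (\<Sum>\<sigma>\<in>perms n. \<Sum>\<pi>\<in>perms n. 1)"
    unfolding sign_sum_def by (rule order_trans[OF sum_abs], rule sum_mono,
      rule order_trans[OF sum_abs], rule sum_mono, rule p)
  also have "\<dots> = fact (2 * n) * fact (2 * n)"
    by (simp only: sum_constant card_perms mult_1_right of_nat_fact)
  finally have "\<bar>sign_sum n u k l\<bar> \<le> (fact (2 * n))\<^sup>2" by (simp add: power2_eq_square)
  then have "real_of_int \<bar>sign_sum n u k l\<bar> \<le> real_of_int ((fact (2 * n))\<^sup>2)" by (simp only: of_int_le_iff)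
  then show ?thesis by simp
qed

subsection \<open>Vanishing by symmetry\<close>

definition reversal :: "nat \<Rightarrow> nat \<Rightarrow> nat" where
  "reversal m v = (if v \<in> {1..m} then m + 1 - v else v)"

lemma reversal_permutes: "reversal m permutes {1..m}"
  by (rule bij_imp_permutes, rule bij_betw_byWitness[where f' = "reversal m"])
    (auto simp: reversal_def)

lemma reversal_less_iff:
  "v \<in> {1..m} \<Longrightarrow> w \<in> {1..m} \<Longrightarrow> reversal m v < reversal m w \<longleftrightarrow> w < v"
  by (auto simp: reversal_def)

text \<open>Reversal turns every chain of inequalities around, which exchanges the two A-conditions.
  The membership facts are needed because \<open>reversal\<close> reverses only
  \<open>{1..2*n}\<close>.\<close>

lemma signA_reversal:
  assumes s: "\<sigma> permutes {1..2*n}" and kl: "k \<in> {1..n}" "l \<in> {1..n}"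
  shows "signA n (reversal (2 * n) \<circ> \<sigma>) k l = - signA n \<sigma> k l"
proof -
  have "k \<in> {1..2*n}" "n + l \<in> {1..2*n}" "cyc n k \<in> {1..2*n}" using kl cyc_in_range[of n k] by auto
  then have "\<sigma> k \<in> {1..2*n}" "\<sigma> (n + l) \<in> {1..2*n}" "\<sigma> (cyc n k) \<in> {1..2*n}"
    by (simp_all only: permutes_in_image[OF s])
  then show ?thesis unfolding signA_def by (simp only: reversal_less_iff comp_apply) auto
qed

lemma lk_reversal:
  assumes "\<sigma> permutes {1..2*n}"
  shows "lk n (reversal (2 * n) \<circ> \<sigma>) \<pi> = - lk n \<sigma> \<pi>"
  unfolding lk_eq_sum_eps eps_perm_less sum_negf[symmetric]
  by (intro sum.cong refl) (simp add: signA_reversal[OF assms])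

text \<open>Composition with the reversal is a bijection on the permutations, so the sum equals its
  own negative.\<close>

lemma lk_moment_odd:
  assumes "odd u"
  shows "lk_moment u n = 0"
proof -
  let ?f = "\<lambda>\<sigma>. \<Sum>\<pi>\<in>perms n. lk n \<sigma> \<pi> ^ u"
  have "sum ?f (perms n) = (\<Sum>\<sigma>\<in>perms n. ?f (reversal (2 * n) \<circ> \<sigma>))"
    by (rule setum_permutations_compose_left[OF reversal_permutes])
  also have "\<dots> = (\<Sum>\<sigma>\<in>perms n. - ?f \<sigma>)"
    using assms by (intro sum.cong refl) (simp add: lk_reversal sum_negf)
  finally have "sum ?f (perms n) = 0" by (simp add: sum_negf)
  then show ?thesis by (simp add: lk_moment_eq_average)
qed

section \<open>Members of weight 1\<close>

text \<open>A member of weight 1 is a single slot \<open>{i}\<close>. Its residue and the next one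
  have offsets 0 and 1, both covered by \<open>spread\<close>, so no other index uses either of
  them.\<close>

lemma weight_one_isolated:
  assumes un: "u < n" and k: "k ` {1..u} \<subseteq> {1..n}" and p: "p \<in> type_of n u k" "weight p = 1"
  obtains i where "i \<in> {1..u}" "cyc n (k i) \<noteq> k i"
    "\<And>i'. i' \<in> {1..u} - {i} \<Longrightarrow> {k i', cyc n (k i')} \<inter> {k i, cyc n (k i)} = {}"
proof -
  define P where "P = type_of n u k"
  have P: "is_type u P" unfolding P_def by (rule type_of_spread[OF un k])
  obtain a where a: "spread n P a" "placed n P a k" unfolding P_def using type_of_spread(2)[OF un k] by blast
  have pP: "p \<in> P" using p by (simp add: P_def)
  have ki: "k i = (cyc n ^^ j) (a p)" if "p \<in> P" "j < length p" "i \<in> p ! j" for p j i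
    using a(2) that unfolding placed_def by blast
  have len: "length p = 1"
    using length_le_weight[OF P pP] is_type_Nil_notin[OF P pP] p(2) by (cases p) auto
  have "card (p ! 0) = 1" using weight_eq_sum[OF P pP] p(2) len by simp
  then obtain i where i: "p ! 0 = {i}" by (auto simp: card_Suc_eq numeral_eq_Suc)
  have iu: "i \<in> {1..u}" using is_type_part(2)[OF P pP, of 0] len i by simp
  have kia: "k i = (cyc n ^^ 0) (a p)" "cyc n (k i) = (cyc n ^^ 1) (a p)"
    using ki[OF pP, of 0 i] len i by auto
  show ?thesis
  proof
    show "i \<in> {1..u}" by (rule iu)
    show "cyc n (k i) \<noteq> k i"
    proof
      assume "cyc n (k i) = k i"
      then have "(1::nat) = 0" using spreadD(2)[OF a(1) pP pP, of 1 0] len kia by simp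
      then show False by simp
    qed
    fix i' assume i': "i' \<in> {1..u} - {i}"
    then have iu': "i' \<in> {1..u}" by simp
    obtain p' j' where s: "p' \<in> P" "j' < length p'" "i' \<in> p' ! j'" using is_type_slot_ex[OF P iu'] .
    have ne: "p' \<noteq> p"
    proof
      assume "p' = p"
      then have "j' = 0" using s(2) len by simp
      then show False using s(3) i i' \<open>p' = p\<close> by simp
    qed
    have kia': "k i' = (cyc n ^^ j') (a p')" "cyc n (k i') = (cyc n ^^ (Suc j')) (a p')"
      using ki[OF s] by auto
    \<comment> \<open>Applied to the offsets \<open>j'\<close>, \<open>Suc j'\<close> for
      \<open>p'\<close> and 0, 1 for \<open>p\<close>; the larger ones may be the residue just
      behind a run.\<close>
    have neq: "(cyc n ^^ x) (a p') \<noteq> (cyc n ^^ y) (a p)" if "x \<le> length p'" "y \<le> length p" for x y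
      using spreadD(1)[OF a(1) s(1) pP that] ne by blast
    have "k i' \<noteq> k i" unfolding kia kia' by (rule neq) (use s len in auto)
    moreover have "k i' \<noteq> cyc n (k i)" unfolding kia(2) kia'(1) by (rule neq) (use s len in auto)
    moreover have "cyc n (k i') \<noteq> k i" unfolding kia(1) kia'(2) by (rule neq) (use s len in auto)
    moreover have "cyc n (k i') \<noteq> cyc n (k i)" unfolding kia(2) kia'(2) by (rule neq) (use s len in auto)
    ultimately show "{k i', cyc n (k i')} \<inter> {k i, cyc n (k i)} = {}" by auto
  qed
qed

lemma prod_flip_one:
  fixes f g :: "'a \<Rightarrow> 'b::comm_ring_1"
  assumes "finite I" "i \<in> I" "g i = - f i" "\<And>j. j \<in> I - {i} \<Longrightarrow> g j = f j"
  shows "prod g I = - prod f I"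
proof -
  have "prod g (I - {i}) = prod f (I - {i})" using assms(4) by (intro prod.cong) auto
  then show ?thesis using assms(1-3) by (simp add: prod.remove[of I i])
qed

lemma sign_sum_zero_left:
  assumes un: "u < n" and k: "k ` {1..u} \<subseteq> {1..n}" and l: "l ` {1..u} \<subseteq> {1..n}"
    and p: "p \<in> type_of n u k" "weight p = 1"
  shows "sign_sum n u k l = 0"
proof -
  obtain i where i: "i \<in> {1..u}" "cyc n (k i) \<noteq> k i"
    "\<And>i'. i' \<in> {1..u} - {i} \<Longrightarrow> {k i', cyc n (k i')} \<inter> {k i, cyc n (k i)} = {}"
    using weight_one_isolated[OF un k p] by blast
  define \<theta> where "\<theta> = Transposition.transpose (k i) (cyc n (k i))"
  have ki: "k i \<in> {1..n}" "cyc n (k i) \<in> {1..n}" using k i(1) un cyc_in_range[of n "k i"]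
    by (auto simp: image_subset_iff)
  have th: "\<theta> permutes {1..2*n}" unfolding \<theta>_def by (rule permutes_swap_id) (use ki in auto)
  \<comment> \<open>The swapped positions are at most \<open>n\<close>, and
    \<open>l i' \<ge> 1\<close> places \<open>n + l i'\<close> beyond them.\<close>
  have thl: "\<theta> (n + l i') = n + l i'" if "i' \<in> {1..u}" for i'
  proof -
    have "l i' \<ge> 1" using l that by (simp add: image_subset_iff)
    then show ?thesis unfolding \<theta>_def by (intro transpose_apply_other) (use ki in auto)
  qed
  have flip: "(\<Prod>j=1..u. signA n (\<sigma> \<circ> \<theta>) (k j) (l j) * signB n \<pi> (k j) (l j)) =
    - (\<Prod>j=1..u. signA n \<sigma> (k j) (l j) * signB n \<pi> (k j) (l j))" for \<sigma> \<pi>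
  proof (rule prod_flip_one[OF _ i(1)])
    have "\<theta> (k i) = cyc n (k i)" "\<theta> (cyc n (k i)) = k i" by (auto simp: \<theta>_def)
    then have "signA n (\<sigma> \<circ> \<theta>) (k i) (l i) = - signA n \<sigma> (k i) (l i)"
      using thl[OF i(1)] unfolding signA_def by auto
    then show "signA n (\<sigma> \<circ> \<theta>) (k i) (l i) * signB n \<pi> (k i) (l i) =
      - (signA n \<sigma> (k i) (l i) * signB n \<pi> (k i) (l i))" by simp
    \<comment> \<open>All other factors use positions disjoint from the swapped pair, so only the
      factor at \<open>i\<close> changes sign.\<close>
    fix j assume j: "j \<in> {1..u} - {i}"
    have "\<theta> (k j) = k j" "\<theta> (cyc n (k j)) = cyc n (k j)"
      using i(3)[OF j] unfolding \<theta>_def by (auto intro: transpose_apply_other)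
    then have "signA n (\<sigma> \<circ> \<theta>) (k j) (l j) = signA n \<sigma> (k j) (l j)"
      using thl[of j] j unfolding signA_def by simp
    then show "signA n (\<sigma> \<circ> \<theta>) (k j) (l j) * signB n \<pi> (k j) (l j) =
      signA n \<sigma> (k j) (l j) * signB n \<pi> (k j) (l j)" by simp
  qed simp
  have "sign_sum n u k l = (\<Sum>\<sigma>\<in>perms n. \<Sum>\<pi>\<in>perms n.
     \<Prod>j=1..u. signA n (\<sigma> \<circ> \<theta>) (k j) (l j) * signB n \<pi> (k j) (l j))"
    unfolding sign_sum_def by (rule sum_permutations_compose_right[OF th])
  also have "\<dots> = - sign_sum n u k l" unfolding flip sign_sum_def by (simp add: sum_negf)
  finally show ?thesis by simp
qed

text \<open>The mirror image of \<open>sign_sum_zero_left\<close>: the swap takes place in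
  \<open>\<pi>\<close>, at the positions of two consecutive primed y-symbols, and leaves the
  x-factors alone.\<close>

lemma sign_sum_zero_right:
  assumes un: "u < n" and k: "k ` {1..u} \<subseteq> {1..n}" and l: "l ` {1..u} \<subseteq> {1..n}"
    and q: "q \<in> type_of n u l" "weight q = 1"
  shows "sign_sum n u k l = 0"
proof -
  obtain i where i: "i \<in> {1..u}" "cyc n (l i) \<noteq> l i"
    "\<And>i'. i' \<in> {1..u} - {i} \<Longrightarrow> {l i', cyc n (l i')} \<inter> {l i, cyc n (l i)} = {}"
    using weight_one_isolated[OF un l q] by blast
  define \<theta> where "\<theta> = Transposition.transpose (n + l i) (n + cyc n (l i))"
  have li: "l i \<in> {1..n}" "cyc n (l i) \<in> {1..n}" using l i(1) un cyc_in_range[of n "l i"]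
    by (auto simp: image_subset_iff)
  have th: "\<theta> permutes {1..2*n}" unfolding \<theta>_def by (rule permutes_swap_id) (use li in auto)
  have thk: "\<theta> (cyc n (k i')) = cyc n (k i')" for i'
  proof -
    have "cyc n (k i') \<le> n" using cyc_in_range[of n "k i'"] un by simp
    then show ?thesis unfolding \<theta>_def by (intro transpose_apply_other) (use li in auto)
  qed
  have flip: "(\<Prod>j=1..u. signA n \<sigma> (k j) (l j) * signB n (\<pi> \<circ> \<theta>) (k j) (l j)) =
    - (\<Prod>j=1..u. signA n \<sigma> (k j) (l j) * signB n \<pi> (k j) (l j))" for \<sigma> \<pi>
  proof (rule prod_flip_one[OF _ i(1)])
    have "\<theta> (n + l i) = n + cyc n (l i)" "\<theta> (n + cyc n (l i)) = n + l i" by (auto simp: \<theta>_def)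
    then have "signB n (\<pi> \<circ> \<theta>) (k i) (l i) = - signB n \<pi> (k i) (l i)"
      using thk[of i] unfolding signB_def by auto
    then show "signA n \<sigma> (k i) (l i) * signB n (\<pi> \<circ> \<theta>) (k i) (l i) =
      - (signA n \<sigma> (k i) (l i) * signB n \<pi> (k i) (l i))" by simp
    fix j assume j: "j \<in> {1..u} - {i}"
    have "\<theta> (n + l j) = n + l j" "\<theta> (n + cyc n (l j)) = n + cyc n (l j)"
      using i(3)[OF j] unfolding \<theta>_def by (auto intro: transpose_apply_other)
    then have "signB n (\<pi> \<circ> \<theta>) (k j) (l j) = signB n \<pi> (k j) (l j)"
      using thk[of j] unfolding signB_def by simp
    then show "signA n \<sigma> (k j) (l j) * signB n (\<pi> \<circ> \<theta>) (k j) (l j) =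
      signA n \<sigma> (k j) (l j) * signB n \<pi> (k j) (l j)" by simp
  qed simp
  have "sign_sum n u k l = (\<Sum>\<sigma>\<in>perms n. \<Sum>\<pi>\<in>perms n.
     \<Prod>j=1..u. signA n \<sigma> (k j) (l j) * signB n (\<pi> \<circ> \<theta>) (k j) (l j))"
    unfolding sign_sum_def by (rule sum.cong[OF refl], rule sum_permutations_compose_right[OF th])
  also have "\<dots> = - sign_sum n u k l" unfolding flip sign_sum_def by (simp add: sum_negf)
  finally show ?thesis by simp
qed

subsection \<open>Invariance of arrangements under relabelling\<close>

text \<open>The values fill the offsets below \<open>length p\<close>. Adding their successors
  contributes just the residue behind each run, so all offsets covered by \<open>spread\<close>
  occur.\<close>

lemma placed_values:
  assumes P: "is_type u P" and a: "placed n P a k"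
  shows "k ` {1..u} = (\<lambda>(p, j). (cyc n ^^ j) (a p)) ` (SIGMA p:P. {..<length p})"
    and "k ` {1..u} \<union> (\<lambda>i. cyc n (k i)) ` {1..u} =
      (\<lambda>(p, j). (cyc n ^^ j) (a p)) ` (SIGMA p:P. {..length p})"
proof -
  let ?f = "\<lambda>(p, j). (cyc n ^^ j) (a p)"
  have ki: "k i = (cyc n ^^ j) (a p)" if "p \<in> P" "j < length p" "i \<in> p ! j" for p j i
    using a that unfolding placed_def by blast
  have ex: "\<exists>i\<in>{1..u}. k i = (cyc n ^^ j) (a p)" if pj: "p \<in> P" "j < length p" for p j
  proof -
    have "\<exists>i\<in>{1..u}. i \<in> p ! j" using is_type_part[OF P pj] by blast
    then show ?thesis using ki[OF pj] by blast
  qed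
  have slot: "\<exists>p j. p \<in> P \<and> j < length p \<and> k i = (cyc n ^^ j) (a p)" if i: "i \<in> {1..u}" for i
  proof -
    obtain p j where s: "p \<in> P" "j < length p" "i \<in> p ! j" using is_type_slot_ex[OF P i] .
    then show ?thesis using ki[OF s] by blast
  qed
  show "k ` {1..u} = ?f ` (SIGMA p:P. {..<length p})"
  proof (intro equalityI subsetI)
    fix v assume "v \<in> k ` {1..u}"
    then obtain i where "i \<in> {1..u}" "v = k i" by blast
    then obtain p j where "p \<in> P" "j < length p" "v = ?f (p, j)" using slot[of i] by auto
    then show "v \<in> ?f ` (SIGMA p:P. {..<length p})" by (intro image_eqI[of v ?f "(p, j)"]) auto
  next
    fix v assume "v \<in> ?f ` (SIGMA p:P. {..<length p})"
    then obtain p j where "p \<in> P" "j < length p" "v = (cyc n ^^ j) (a p)" by auto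
    then show "v \<in> k ` {1..u}" using ex[of p j] by (metis imageI)
  qed
  show "k ` {1..u} \<union> (\<lambda>i. cyc n (k i)) ` {1..u} = ?f ` (SIGMA p:P. {..length p})"
  proof (intro equalityI subsetI)
    fix v assume "v \<in> k ` {1..u} \<union> (\<lambda>i. cyc n (k i)) ` {1..u}"
    then obtain i where i: "i \<in> {1..u}" and v: "v = k i \<or> v = cyc n (k i)" by blast
    obtain p j where s: "p \<in> P" "j < length p" "k i = (cyc n ^^ j) (a p)" using slot[OF i] by blast
    have m: "(p, j) \<in> (SIGMA p:P. {..length p})" "(p, Suc j) \<in> (SIGMA p:P. {..length p})"
      using s by auto
    show "v \<in> ?f ` (SIGMA p:P. {..length p})"
      using v
    proof
      assume "v = k i"
      then have "v = ?f (p, j)" using s(3) by simp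
      then show ?thesis using m(1) by (rule image_eqI)
    next
      assume "v = cyc n (k i)"
      then have "v = ?f (p, Suc j)" using s(3) by simp
      then show ?thesis using m(2) by (rule image_eqI)
    qed
  next
    fix v assume "v \<in> ?f ` (SIGMA p:P. {..length p})"
    then obtain p j where s: "p \<in> P" "j \<le> length p" "v = (cyc n ^^ j) (a p)" by auto
    show "v \<in> k ` {1..u} \<union> (\<lambda>i. cyc n (k i)) ` {1..u}"
    proof (cases "j < length p")
      case True
      then show ?thesis using ex[OF s(1) True] s(3) by (metis UnI1 imageI)
    next
      \<comment> \<open>The offset \<open>length p\<close> is the successor of the last slot, which
        exists since members are nonempty.\<close>
      case False
      then obtain j' where j': "j = Suc j'" "j' < length p"
        using s(2) is_type_Nil_notin[OF P s(1)] by (cases j) auto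
      obtain i where "i \<in> {1..u}" "k i = (cyc n ^^ j') (a p)" using ex[OF s(1) j'(2)] by blast
      then have "i \<in> {1..u}" "v = cyc n (k i)" using s(3) j'(1) by auto
      then show ?thesis by blast
    qed
  qed
qed

lemma card_values:
  assumes un: "u < n" and k: "k ` {1..u} \<subseteq> {1..n}" and T: "type_of n u k = P"
  shows "card (k ` {1..u}) = (\<Sum>p\<in>P. length p)"
    and "card (k ` {1..u} \<union> (\<lambda>i. cyc n (k i)) ` {1..u}) = (\<Sum>p\<in>P. length p) + card P"
proof -
  have P: "is_type u P" using type_of_spread(1)[OF un k] T by simp
  obtain a where a: "spread n P a" "placed n P a k" using type_of_spread(2)[OF un k] T by blast
  have fin: "finite P" by (rule is_type_finite[OF P])
  have inj: "inj_on (\<lambda>(p, j). (cyc n ^^ j) (a p)) (SIGMA p:P. {..length p})"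
    using a(1) unfolding spread_def by blast
  have inj': "inj_on (\<lambda>(p, j). (cyc n ^^ j) (a p)) (SIGMA p:P. {..<length p})"
    by (rule inj_on_subset[OF inj]) auto
  show "card (k ` {1..u}) = (\<Sum>p\<in>P. length p)"
    unfolding placed_values(1)[OF P a(2)] using fin by (simp add: card_image[OF inj'] card_SigmaI)
  show "card (k ` {1..u} \<union> (\<lambda>i. cyc n (k i)) ` {1..u}) = (\<Sum>p\<in>P. length p) + card P"
    unfolding placed_values(2)[OF P a(2)] using fin
    by (simp add: card_image[OF inj] card_SigmaI sum.distrib sum_Suc)
qed

lemma symbX_eq: "symbX n u k l =
    Fst ` (k ` {1..u} \<union> (\<lambda>i. cyc n (k i)) ` {1..u}) \<union> Snd ` (l ` {1..u})"
  unfolding symbX_def by auto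

lemma symbY_eq: "symbY n u k l =
    Fst ` ((\<lambda>i. cyc n (k i)) ` {1..u}) \<union> Snd ` (l ` {1..u} \<union> (\<lambda>i. cyc n (l i)) ` {1..u})"
  unfolding symbY_def by auto

lemma finite_symbX: "finite (symbX n u k l)" and finite_symbY: "finite (symbY n u k l)"
  unfolding symbX_def symbY_def by auto

text \<open>Each run contributes its length, plus one where both a value and its successor appear.
  Among the x-symbols this happens for the unprimed ones, giving \<open>card P\<close>; among the
  y-symbols for the primed ones, giving \<open>card Q\<close>.\<close>

lemma card_symbols:
  assumes un: "u < n" and k: "k ` {1..u} \<subseteq> {1..n}" and l: "l ` {1..u} \<subseteq> {1..n}"
    and T: "type_of n u k = P" "type_of n u l = Q"
  shows "card (symbX n u k l) = card P + ((\<Sum>p\<in>P. length p) + (\<Sum>q\<in>Q. length q))"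
    and "card (symbY n u k l) = card Q + ((\<Sum>p\<in>P. length p) + (\<Sum>q\<in>Q. length q))"
proof -
  have cardF: "card (Fst ` A \<union> Snd ` B) = card A + card B" if "finite A" "finite B" for A B
    using that by (subst card_Un_disjoint) (auto simp: card_image inj_on_def)
  have "card ((\<lambda>i. cyc n (k i)) ` {1..u}) = card (cyc n ` (k ` {1..u}))" by (simp add: image_image)
  also have "\<dots> = card (k ` {1..u})" by (rule card_image[OF inj_on_subset[OF cyc_inj_on k]])
  finally have ck: "card ((\<lambda>i. cyc n (k i)) ` {1..u}) = card (k ` {1..u})" .
  show "card (symbX n u k l) = card P + ((\<Sum>p\<in>P. length p) + (\<Sum>q\<in>Q. length q))"
    unfolding symbX_eq by (subst cardF) (simp_all only: finite_Un finite_imageI finite_atLeastAtMost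
      card_values[OF un k T(1)] card_values[OF un l T(2)] simp_thms ac_simps)
  show "card (symbY n u k l) = card Q + ((\<Sum>p\<in>P. length p) + (\<Sum>q\<in>Q. length q))"
    unfolding symbY_eq by (subst cardF) (simp_all only: finite_Un finite_imageI finite_atLeastAtMost ck
      card_values[OF un k T(1)] card_values[OF un l T(2)] simp_thms ac_simps)
qed

text \<open>Both sequences are placements of the same type, so residues with the same member and
  offset correspond. The offset \<open>length p\<close> is included in order to relabel successors
  as well.\<close>

lemma same_type_relabelling:
  assumes un: "u < n" "k ` {1..u} \<subseteq> {1..n}" and un': "u < n'" "k' ` {1..u} \<subseteq> {1..n'}"
    and T: "type_of n u k = type_of n' u k'"
  obtains \<phi> where "inj_on \<phi> (k ` {1..u} \<union> (\<lambda>i. cyc n (k i)) ` {1..u})"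
    "\<And>i. i \<in> {1..u} \<Longrightarrow> \<phi> (k i) = k' i" "\<And>i. i \<in> {1..u} \<Longrightarrow> \<phi> (cyc n (k i)) = cyc n' (k' i)"
proof -
  define P where "P = type_of n u k"
  have P: "is_type u P" unfolding P_def by (rule type_of_spread(1)[OF un])
  obtain a where a: "spread n P a" "placed n P a k"
    using type_of_spread(2)[OF un] unfolding P_def by blast
  obtain a' where a': "spread n' P a'" "placed n' P a' k'"
    using type_of_spread(2)[OF un'] unfolding P_def T by blast
  let ?S = "SIGMA p:P. {..length p}"
  let ?f = "\<lambda>(p, j). (cyc n ^^ j) (a p)" and ?f' = "\<lambda>(p, j). (cyc n' ^^ j) (a' p)"
  have inj: "inj_on ?f ?S" "inj_on ?f' ?S" using a(1) a'(1) unfolding spread_def by auto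
  define \<phi> where "\<phi> = ?f' \<circ> inv_into ?S ?f"
  have \<phi>: "\<phi> (?f x) = ?f' x" if "x \<in> ?S" for x
    unfolding \<phi>_def comp_apply inv_into_f_f[OF inj(1) that] ..
  show ?thesis
  proof
    show "inj_on \<phi> (k ` {1..u} \<union> (\<lambda>i. cyc n (k i)) ` {1..u})"
      unfolding placed_values(2)[OF P a(2)] \<phi>_def
    proof (rule comp_inj_on)
      show "inj_on (inv_into ?S ?f) (?f ` ?S)" by (rule inj_on_inv_into) simp
      have "inv_into ?S ?f ` ?f ` ?S \<subseteq> ?S" by (intro image_subsetI inv_into_into)
      then show "inj_on ?f' (inv_into ?S ?f ` ?f ` ?S)" by (rule inj_on_subset[OF inj(2)])
    qed
    fix i assume i: "i \<in> {1..u}"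
    obtain p j where s: "p \<in> P" "j < length p" "i \<in> p ! j" using is_type_slot_ex[OF P i] .
    have m: "(p, j) \<in> ?S" "(p, Suc j) \<in> ?S" using s by auto
    have k: "k i = ?f (p, j)" "k' i = ?f' (p, j)" using a(2) a'(2) s unfolding placed_def by simp_all
    have c: "cyc n (k i) = ?f (p, Suc j)" "cyc n' (k' i) = ?f' (p, Suc j)" unfolding k by simp_all
    show "\<phi> (k i) = k' i" unfolding k by (rule \<phi>[OF m(1)])
    show "\<phi> (cyc n (k i)) = cyc n' (k' i)" unfolding c by (rule \<phi>[OF m(2)])
  qed
qed

section \<open>Transport of orders along a relabelling\<close>

lemma strict_map_prod:
  assumes "inj_on h X" "r \<subseteq> X \<times> X" "a \<in> X" "b \<in> X"
  shows "strict (map_prod h h ` r) (h a) (h b) \<longleftrightarrow> strict r a b"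
proof -
  have "(h a, h b) \<in> map_prod h h ` r \<longleftrightarrow> (a, b) \<in> r"
  proof
    assume "(h a, h b) \<in> map_prod h h ` r"
    then obtain c d where "(c, d) \<in> r" "h a = h c" "h b = h d" by auto
    moreover from this have "c \<in> X" "d \<in> X" using assms(2) by auto
    ultimately show "(a, b) \<in> r" using assms by (metis inj_onD)
  qed force
  moreover have "h a = h b \<longleftrightarrow> a = b" using assms by (meson inj_on_eq_iff)
  ultimately show ?thesis unfolding strict_def by simp
qed

lemma linear_order_on_map_prod:
  assumes inj: "inj_on h X" and r: "linear_order_on X r"
  shows "linear_order_on (h ` X) (map_prod h h ` r)"
proof -
  note L = linear_order_onD[OF r]
  have eq: "a = b" if "a \<in> X" "b \<in> X" "h a = h b" for a b using inj that by (auto dest: inj_onD)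
  have X: "a \<in> X" "b \<in> X" if "(a, b) \<in> r" for a b using L(1) that by auto
  show ?thesis
  proof (rule linear_order_onI)
    show "map_prod h h ` r \<subseteq> h ` X \<times> h ` X" using X by auto
    show "(a, a) \<in> map_prod h h ` r" if "a \<in> h ` X" for a using L(2) that by force
    show "(x, z) \<in> map_prod h h ` r" if "(x, y) \<in> map_prod h h ` r" "(y, z) \<in> map_prod h h ` r" for x y z
    proof -
      from that obtain a b b' c where *: "(a, b) \<in> r" "(b', c) \<in> r" "x = h a" "y = h b" "y = h b'" "z = h c"
        by auto
      then have "b = b'" using eq X by metis
      then have "(a, c) \<in> r" using * L(3) by blast
      then show ?thesis using * by force
    qed
    show "x = y" if "(x, y) \<in> map_prod h h ` r" "(y, x) \<in> map_prod h h ` r" for x y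
    proof -
      from that obtain a b a' b' where *: "(a, b) \<in> r" "(b', a') \<in> r" "x = h a" "y = h b" "y = h b'" "x = h a'"
        by auto
      then have "b = b'" "a = a'" using eq X by metis+
      then have "a = b" using * L(4) by blast
      then show ?thesis using * by simp
    qed
    show "(x, y) \<in> map_prod h h ` r \<or> (y, x) \<in> map_prod h h ` r" if xy: "x \<in> h ` X" "y \<in> h ` X" for x y
    proof -
      from xy obtain a b where *: "a \<in> X" "b \<in> X" "x = h a" "y = h b" by auto
      show ?thesis using L(5)[OF *(1,2)] *(3,4) by force
    qed
  qed
qed

lemma inj_on_image_map_prod:
  assumes "inj_on h X"
  shows "inj_on (\<lambda>r. map_prod h h ` r) (Pow (X \<times> X))"
  using map_prod_inj_on[OF assms assms] by (rule inj_on_image_Pow)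

text \<open>Relabelling the symbols carries arrangements injectively to arrangements with the same
  signs. The hypotheses are symmetric, so the inequality suffices for equality later.\<close>

lemma card_arrangements_le:
  assumes un: "u < n" "k ` {1..u} \<subseteq> {1..n}" "l ` {1..u} \<subseteq> {1..n}"
    and un': "u < n'" "k' ` {1..u} \<subseteq> {1..n'}" "l' ` {1..u} \<subseteq> {1..n'}"
    and T: "type_of n u k = type_of n' u k'" "type_of n u l = type_of n' u l'"
  shows "card (arrangements n u k l \<epsilon>) \<le> card (arrangements n' u k' l' \<epsilon>)"
proof -
  obtain \<phi> where \<phi>: "inj_on \<phi> (k ` {1..u} \<union> (\<lambda>i. cyc n (k i)) ` {1..u})"
    "\<And>i. i \<in> {1..u} \<Longrightarrow> \<phi> (k i) = k' i" "\<And>i. i \<in> {1..u} \<Longrightarrow> \<phi> (cyc n (k i)) = cyc n' (k' i)"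
    using same_type_relabelling[OF un(1,2) un'(1,2) T(1)] by blast
  obtain \<psi> where \<psi>: "inj_on \<psi> (l ` {1..u} \<union> (\<lambda>i. cyc n (l i)) ` {1..u})"
    "\<And>i. i \<in> {1..u} \<Longrightarrow> \<psi> (l i) = l' i" "\<And>i. i \<in> {1..u} \<Longrightarrow> \<psi> (cyc n (l i)) = cyc n' (l' i)"
    using same_type_relabelling[OF un(1,3) un'(1,3) T(2)] by blast
  define h where "h s = (case s of Fst a \<Rightarrow> Fst (\<phi> a) | Snd b \<Rightarrow> Snd (\<psi> b))" for s
  let ?X = "symbX n u k l" and ?Y = "symbY n u k l"
  have "inj_on h (Fst ` (k ` {1..u} \<union> (\<lambda>i. cyc n (k i)) ` {1..u}) \<union>
      Snd ` (l ` {1..u} \<union> (\<lambda>i. cyc n (l i)) ` {1..u}))" (is "inj_on h ?Z")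
  proof (rule inj_onI)
    fix s t assume st: "s \<in> ?Z" "t \<in> ?Z" "h s = h t"
    show "s = t"
    proof (cases s)
      case (Fst a)
      then obtain b where b: "t = Fst b" using st(3) by (cases t) (auto simp: h_def)
      show ?thesis using inj_onD[OF \<phi>(1), of a b] st Fst b by (auto simp: h_def)
    next
      case (Snd a)
      then obtain b where b: "t = Snd b" using st(3) by (cases t) (auto simp: h_def)
      show ?thesis using inj_onD[OF \<psi>(1), of a b] st Snd b by (auto simp: h_def)
    qed
  qed
  then have hX: "inj_on h ?X" and hY: "inj_on h ?Y"
    unfolding symbX_eq symbY_eq by (auto intro: inj_on_subset)
  have hF: "h (Fst (k i)) = Fst (k' i)" "h (Fst (cyc n (k i))) = Fst (cyc n' (k' i))"
    "h (Snd (l i)) = Snd (l' i)" "h (Snd (cyc n (l i))) = Snd (cyc n' (l' i))" if "i \<in> {1..u}" for i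
    using \<phi>(2,3) \<psi>(2,3) that by (auto simp: h_def)
  have imX: "h ` ?X = symbX n' u k' l'" and imY: "h ` ?Y = symbY n' u k' l'"
    unfolding symbX_def symbY_def image_UN by (intro SUP_cong refl; simp add: hF)+
  define H where "H = map_prod (\<lambda>r. map_prod h h ` r) (\<lambda>s. map_prod h h ` s)"
  have lin: "r \<subseteq> ?X \<times> ?X" "s \<subseteq> ?Y \<times> ?Y" if "(r, s) \<in> arrangements n u k l \<epsilon>" for r s
    using that linear_order_onD(1) unfolding arrangements_def by blast+
  have "arrangements n u k l \<epsilon> \<subseteq> Pow (?X \<times> ?X) \<times> Pow (?Y \<times> ?Y)"
  proof
    fix x assume x: "x \<in> arrangements n u k l \<epsilon>"
    obtain r s where rs: "x = (r, s)" by (cases x)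
    show "x \<in> Pow (?X \<times> ?X) \<times> Pow (?Y \<times> ?Y)" using lin[of r s] x rs by simp
  qed
  then have "inj_on H (arrangements n u k l \<epsilon>)"
    unfolding H_def
    by (rule inj_on_subset[OF map_prod_inj_on[OF inj_on_image_map_prod[OF hX] inj_on_image_map_prod[OF hY]]])
  moreover have "H ` arrangements n u k l \<epsilon> \<subseteq> arrangements n' u k' l' \<epsilon>"
  proof (rule image_subsetI)
    fix x assume x: "x \<in> arrangements n u k l \<epsilon>"
    obtain r s where rs: "x = (r, s)" by (cases x)
    have r: "linear_order_on ?X r" and s: "linear_order_on ?Y s"
      and e: "\<And>i. i \<in> {1..u} \<Longrightarrow> eps n (strict r) (strict s) (k i) (l i) = \<epsilon> i"
      using x rs unfolding arrangements_def by auto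
    let ?r = "map_prod h h ` r" and ?s = "map_prod h h ` s"
    have "eps n' (strict ?r) (strict ?s) (k' i) (l' i) = \<epsilon> i" if i: "i \<in> {1..u}" for i
    proof -
      have mX: "Fst (k i) \<in> ?X" "Fst (cyc n (k i)) \<in> ?X" "Snd (l i) \<in> ?X"
        and mY: "Fst (cyc n (k i)) \<in> ?Y" "Snd (l i) \<in> ?Y" "Snd (cyc n (l i)) \<in> ?Y"
        using i unfolding symbX_def symbY_def by blast+
      note sX = strict_map_prod[OF hX linear_order_onD(1)[OF r]]
      note sY = strict_map_prod[OF hY linear_order_onD(1)[OF s]]
      \<comment> \<open>The A-conditions compare only symbols of \<open>symbX\<close>, where
        \<open>h\<close> preserves the strict order; likewise for B and
        \<open>symbY\<close>.\<close>
      have A: "condA n' (strict ?r) \<delta> (k' i) (l' i) = condA n (strict r) \<delta> (k i) (l i)" for \<delta>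
        using sX[OF mX(1,3)] sX[OF mX(3,2)] sX[OF mX(2,3)] sX[OF mX(3,1)]
        unfolding condA_def hF[OF i] by simp
      have B: "condB n' (strict ?s) \<delta> (k' i) (l' i) = condB n (strict s) \<delta> (k i) (l i)" for \<delta>
        using sY[OF mY(3,1)] sY[OF mY(1,2)] sY[OF mY(2,1)] sY[OF mY(1,3)]
        unfolding condB_def hF[OF i] by simp
      show ?thesis using e[OF i] unfolding eps_def A B .
    qed
    then show "H x \<in> arrangements n' u k' l' \<epsilon>"
      using linear_order_on_map_prod[OF hX r] linear_order_on_map_prod[OF hY s]
      unfolding rs H_def arrangements_def imX imY by simp
  qed
  moreover have "finite (arrangements n' u k' l' \<epsilon>)"
    by (rule finite_subset[of _ "{r. linear_order_on (symbX n' u k' l') r} \<times> {s. linear_order_on (symbY n' u k' l') s}"])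
      (auto simp: arrangements_def finite_linear_orders finite_symbX finite_symbY)
  ultimately show ?thesis by (rule card_inj_on_le)
qed

text \<open>This justifies the definite description in \<open>num_arr\<close>: a representative
  exists by hypothesis, and all representatives give the same number. The assumption
  \<open>u \<ge> 1\<close> turns \<open>2 * u \<le> n\<close> into \<open>u < n\<close>.\<close>

lemma num_arr_eq:
  assumes "u \<ge> 1" and rep: "represents n k l u P Q"
  shows "num_arr u P Q \<epsilon> = card (arrangements n u k l \<epsilon>)"
  unfolding num_arr_def
proof (rule the_equality)
  show "\<forall>n' k' l'. represents n' k' l' u P Q \<longrightarrow>
    card (arrangements n' u k' l' \<epsilon>) = card (arrangements n u k l \<epsilon>)"
  proof (intro allI impI)
    fix n' k' l' assume rep': "represents n' k' l' u P Q"
    have D: "u < n \<and> k ` {1..u} \<subseteq> {1..n} \<and> l ` {1..u} \<subseteq> {1..n} \<and> type_of n u k = P \<and> type_of n u l = Q"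
      if "represents n k l u P Q" for n k l
      using that assms(1) unfolding represents_def by (auto simp: PiE_iff)
    note D1 = D[OF rep] and D2 = D[OF rep']
    show "card (arrangements n' u k' l' \<epsilon>) = card (arrangements n u k l \<epsilon>)"
      by (rule antisym; rule card_arrangements_le) (use D1 D2 in auto)
  qed
  then show "c = card (arrangements n u k l \<epsilon>)"
    if "\<forall>n k l. represents n k l u P Q \<longrightarrow> card (arrangements n u k l \<epsilon>) = c" for c
    using that rep by metis
qed

subsection \<open>Signs and arrangements\<close>

text \<open>If no factor vanishes, exactly one extensional sign pattern agrees with \<open>g\<close>
  on \<open>I\<close>; if some factor is 0, none does.\<close>

lemma prod_eq_sum_signs:
  fixes g :: "'a \<Rightarrow> int"
  assumes "finite I" "\<And>i. i \<in> I \<Longrightarrow> g i \<in> {-1, 0, 1}"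
  shows "prod g I = (\<Sum>\<epsilon>\<in>I \<rightarrow>\<^sub>E {-1, 1}. if \<forall>i\<in>I. g i = \<epsilon> i then prod \<epsilon> I else 0)"
proof -
  have "prod g I = (\<Prod>i\<in>I. \<Sum>e\<in>{-1, 1}. if g i = e then e else 0)"
    by (rule prod.cong[OF refl]) (use assms(2) in auto)
  also have "\<dots> = (\<Sum>\<epsilon>\<in>I \<rightarrow>\<^sub>E {-1, 1}. \<Prod>i\<in>I. if g i = \<epsilon> i then \<epsilon> i else 0)"
    by (rule prod_sum_PiE) (use assms(1) in auto)
  also have "\<dots> = (\<Sum>\<epsilon>\<in>I \<rightarrow>\<^sub>E {-1, 1}. if \<forall>i\<in>I. g i = \<epsilon> i then prod \<epsilon> I else 0)"
  proof (rule sum.cong[OF refl])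
    fix \<epsilon> :: "'a \<Rightarrow> int"
    show "(\<Prod>i\<in>I. if g i = \<epsilon> i then \<epsilon> i else 0) = (if \<forall>i\<in>I. g i = \<epsilon> i then prod \<epsilon> I else 0)"
    proof (cases "\<forall>i\<in>I. g i = \<epsilon> i")
      case False
      then have "\<exists>i\<in>I. (if g i = \<epsilon> i then \<epsilon> i else 0) = 0" by auto
      then have "(\<Prod>i\<in>I. if g i = \<epsilon> i then \<epsilon> i else 0) = 0" by (rule prod_zero[OF assms(1)])
      then show ?thesis unfolding if_not_P[OF False] .
    qed simp
  qed
  finally show ?thesis .
qed

definition symbols :: "nat \<Rightarrow> symb set" where
  "symbols n = Fst ` {1..n} \<union> Snd ` {1..n}"

text \<open>\<open>symb_val n id\<close> sends a symbol to its position in the one-line notation, so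
  it can act as the embedding in \<open>card_permutations_inducing_order\<close>.\<close>

lemma inj_on_symb_val_id: "inj_on (symb_val n id) (symbols n)"
  unfolding symbols_def by (rule inj_onI) auto

lemma symb_val_id_range: "symb_val n id ` symbols n \<subseteq> {1..2 * n}"
  unfolding symbols_def by auto

lemma symb_val_eq: "symb_val n \<sigma> a = \<sigma> (symb_val n id a)"
  by (cases a) auto

lemma symbX_subset: "n > 0 \<Longrightarrow> k ` {1..u} \<subseteq> {1..n} \<Longrightarrow> l ` {1..u} \<subseteq> {1..n} \<Longrightarrow> symbX n u k l \<subseteq> symbols n"
  and symbY_subset: "n > 0 \<Longrightarrow> k ` {1..u} \<subseteq> {1..n} \<Longrightarrow> l ` {1..u} \<subseteq> {1..n} \<Longrightarrow> symbY n u k l \<subseteq> symbols n"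
  unfolding symbX_def symbY_def symbols_def
  by (intro UN_least; use cyc_in_range in \<open>simp add: image_subset_iff\<close>)+

lemma strict_order_on_of:
  assumes X: "X \<subseteq> symbols n" and s: "\<sigma> permutes {1..2*n}" and ab: "a \<in> X" "b \<in> X"
  shows "strict (order_on_of X (\<sigma> \<circ> symb_val n id)) a b \<longleftrightarrow> perm_less n \<sigma> a b"
proof -
  have "\<sigma> (symb_val n id a) = \<sigma> (symb_val n id b) \<longleftrightarrow> a = b"
    using injD[OF permutes_inj[OF s]] inj_onD[OF inj_on_symb_val_id, of n a b] X ab by auto
  then show ?thesis
    using ab unfolding strict_def perm_less_def symb_val_eq[of n \<sigma>] order_on_of_def by auto
qed

lemma eps_order_on_of:
  assumes X: "symbX n u k l \<subseteq> symbols n" "symbY n u k l \<subseteq> symbols n"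
    and s: "\<sigma> permutes {1..2*n}" "\<pi> permutes {1..2*n}" and i: "i \<in> {1..u}"
  shows "eps n (strict (order_on_of (symbX n u k l) (\<sigma> \<circ> symb_val n id)))
      (strict (order_on_of (symbY n u k l) (\<pi> \<circ> symb_val n id))) (k i) (l i) =
    signA n \<sigma> (k i) (l i) * signB n \<pi> (k i) (l i)"
proof -
  have mX: "Fst (k i) \<in> symbX n u k l" "Fst (cyc n (k i)) \<in> symbX n u k l" "Snd (l i) \<in> symbX n u k l"
    and mY: "Fst (cyc n (k i)) \<in> symbY n u k l" "Snd (l i) \<in> symbY n u k l" "Snd (cyc n (l i)) \<in> symbY n u k l"
    using i unfolding symbX_def symbY_def by auto
  note sX = strict_order_on_of[OF X(1) s(1)] and sY = strict_order_on_of[OF X(2) s(2)]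
  have A: "condA n (strict (order_on_of (symbX n u k l) (\<sigma> \<circ> symb_val n id))) \<delta> (k i) (l i) =
      condA n (perm_less n \<sigma>) \<delta> (k i) (l i)" for \<delta>
    unfolding condA_def sX[OF mX(1,3)] sX[OF mX(3,2)] sX[OF mX(2,3)] sX[OF mX(3,1)] ..
  have B: "condB n (strict (order_on_of (symbY n u k l) (\<pi> \<circ> symb_val n id))) \<delta> (k i) (l i) =
      condB n (perm_less n \<pi>) \<delta> (k i) (l i)" for \<delta>
    unfolding condB_def sY[OF mY(3,1)] sY[OF mY(1,2)] sY[OF mY(2,1)] sY[OF mY(1,3)] ..
  show ?thesis unfolding eps_perm_less[symmetric] eps_def A B ..
qed

text \<open>The signs depend only on the orders that the permutations induce on the symbols. The
  event is thus a disjoint union, over the arrangements, of products of two classes of permutations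
  inducing a given order, whose sizes are known.\<close>

lemma card_inducing_signs:
  assumes n: "n > 0" and k: "k ` {1..u} \<subseteq> {1..n}" and l: "l ` {1..u} \<subseteq> {1..n}"
  shows "card {x \<in> perms n \<times> perms n. \<forall>i\<in>{1..u}. signA n (fst x) (k i) (l i) * signB n (snd x) (k i) (l i) = \<epsilon> i}
      * (fact (card (symbX n u k l)) * fact (card (symbY n u k l))) =
    card (arrangements n u k l \<epsilon>) * (fact (2 * n))\<^sup>2"
    (is "card ?C * _ = _")
proof -
  let ?X = "symbX n u k l" and ?Y = "symbY n u k l" and ?\<iota> = "symb_val n id"
  have X: "?X \<subseteq> symbols n" and Y: "?Y \<subseteq> symbols n"
    using symbX_subset symbY_subset n k l by blast+
  define S where "S X r = {\<sigma>. \<sigma> permutes {1..2*n} \<and> order_on_of X (\<sigma> \<circ> ?\<iota>) = r}" for X r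
  have card_S: "card (S X r) * fact (card X) = fact (2 * n)"
    if "X \<subseteq> symbols n" "linear_order_on X r" for X r
  proof -
    have "?\<iota> ` X \<subseteq> {1..2*n}" using symb_val_id_range that(1) by blast
    from card_permutations_inducing_order[OF _ inj_on_subset[OF inj_on_symb_val_id that(1)] this that(2)]
    show ?thesis unfolding S_def by simp
  qed
  let ?A = "arrangements n u k l \<epsilon>"
  have finA: "finite ?A"
    by (rule finite_subset[of _ "{r. linear_order_on ?X r} \<times> {s. linear_order_on ?Y s}"])
      (auto simp: arrangements_def finite_linear_orders finite_symbX finite_symbY)
  have finS: "finite (S X r)" for X r unfolding S_def using finite_perms[of n] by simp
  have "?C = (\<Union>x\<in>?A. S ?X (fst x) \<times> S ?Y (snd x))"
  proof (intro equalityI subsetI)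
    fix x assume x: "x \<in> ?C"
    obtain \<sigma> \<pi> where sp: "x = (\<sigma>, \<pi>)" by (cases x)
    then have p: "\<sigma> permutes {1..2*n}" "\<pi> permutes {1..2*n}" using x by auto
    let ?r = "order_on_of ?X (\<sigma> \<circ> ?\<iota>)" and ?s = "order_on_of ?Y (\<pi> \<circ> ?\<iota>)"
    have "linear_order_on Z (order_on_of Z (\<tau> \<circ> ?\<iota>))"
      if "Z \<subseteq> symbols n" "\<tau> permutes {1..2*n}" for Z \<tau>
      using comp_inj_on[OF inj_on_subset[OF inj_on_symb_val_id that(1)] permutes_inj_on[OF that(2)]]
      by (rule linear_order_on_order_on_of)
    then have "(?r, ?s) \<in> ?A"
      unfolding arrangements_def using X Y p x sp eps_order_on_of[OF X Y p] by simp
    moreover have "x \<in> S ?X ?r \<times> S ?Y ?s" unfolding S_def sp using p by simp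
    ultimately show "x \<in> (\<Union>x\<in>?A. S ?X (fst x) \<times> S ?Y (snd x))" by force
  next
    fix x assume "x \<in> (\<Union>x\<in>?A. S ?X (fst x) \<times> S ?Y (snd x))"
    then obtain r s \<sigma> \<pi> where *: "(r, s) \<in> ?A" "x = (\<sigma>, \<pi>)" "\<sigma> \<in> S ?X r" "\<pi> \<in> S ?Y s" by auto
    then have p: "\<sigma> permutes {1..2*n}" "\<pi> permutes {1..2*n}"
      and rs: "r = order_on_of ?X (\<sigma> \<circ> ?\<iota>)" "s = order_on_of ?Y (\<pi> \<circ> ?\<iota>)"
      unfolding S_def by auto
    have "eps n (strict r) (strict s) (k i) (l i) = \<epsilon> i" if "i \<in> {1..u}" for i
      using *(1) that unfolding arrangements_def by simp
    then show "x \<in> ?C" unfolding rs using eps_order_on_of[OF X Y p] p *(2) by simp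
  qed
  then have "card ?C = card (\<Union>x\<in>?A. S ?X (fst x) \<times> S ?Y (snd x))" by simp
  also have "\<dots> = (\<Sum>x\<in>?A. card (S ?X (fst x) \<times> S ?Y (snd x)))"
    by (rule card_UN_disjoint) (use finA finS in \<open>auto simp: S_def\<close>)
  finally have card_C: "card ?C = \<dots>" .
  have "card ?C * (fact (card ?X) * fact (card ?Y)) =
    (\<Sum>x\<in>?A. (card (S ?X (fst x)) * fact (card ?X)) * (card (S ?Y (snd x)) * fact (card ?Y)))"
    unfolding card_C sum_distrib_right card_cartesian_product
    by (intro sum.cong refl) (simp only: mult_ac)
  also have "\<dots> = (\<Sum>x\<in>?A. fact (2 * n) * fact (2 * n))"
    by (intro sum.cong refl arg_cong2[where f = "(*)"] card_S X Y) (auto simp: arrangements_def)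
  finally show ?thesis by (simp add: power2_eq_square)
qed

lemma sign_sum_eq_arrangements:
  assumes n: "n > 0" and k: "k ` {1..u} \<subseteq> {1..n}" and l: "l ` {1..u} \<subseteq> {1..n}"
  shows "real_of_int (sign_sum n u k l) / (fact (2 * n))\<^sup>2 =
    (\<Sum>\<epsilon>\<in>{1..u} \<rightarrow>\<^sub>E {-1, 1}. of_int (\<Prod>i=1..u. \<epsilon> i) *
      (real (card (arrangements n u k l \<epsilon>)) / (fact (card (symbX n u k l)) * fact (card (symbY n u k l)))))"
proof -
  let ?E = "{1..u} \<rightarrow>\<^sub>E {-1, 1 :: int}"
  define g where "g x i = signA n (fst x) (k i) (l i) * signB n (snd x) (k i) (l i)" for x i
  define C where "C \<epsilon> = {x \<in> perms n \<times> perms n. \<forall>i\<in>{1..u}. g x i = \<epsilon> i}" for \<epsilon>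
  have g: "g x i \<in> {-1, 0, 1}" for x i unfolding g_def signA_def signB_def by simp
  have fin: "finite (perms n \<times> perms n)" using finite_perms[of n] by simp
  have "sign_sum n u k l = (\<Sum>x\<in>perms n \<times> perms n. \<Prod>i=1..u. g x i)"
    unfolding sign_sum_def g_def sum.cartesian_product by (simp add: case_prod_unfold)
  also have "\<dots> = (\<Sum>x\<in>perms n \<times> perms n. \<Sum>\<epsilon>\<in>?E. if \<forall>i\<in>{1..u}. g x i = \<epsilon> i then \<Prod>i=1..u. \<epsilon> i else 0)"
    by (intro sum.cong refl prod_eq_sum_signs g) simp
  also have "\<dots> = (\<Sum>\<epsilon>\<in>?E. \<Sum>x\<in>perms n \<times> perms n. if \<forall>i\<in>{1..u}. g x i = \<epsilon> i then \<Prod>i=1..u. \<epsilon> i else 0)"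
    by (rule sum.swap)
  also have "\<dots> = (\<Sum>\<epsilon>\<in>?E. \<Sum>x\<in>C \<epsilon>. \<Prod>i=1..u. \<epsilon> i)"
    unfolding C_def by (intro sum.cong refl sum.inter_filter[symmetric] fin)
  also have "\<dots> = (\<Sum>\<epsilon>\<in>?E. (\<Prod>i=1..u. \<epsilon> i) * int (card (C \<epsilon>)))" by (simp add: mult.commute)
  finally have sum: "real_of_int (sign_sum n u k l) / (fact (2 * n))\<^sup>2 =
    (\<Sum>\<epsilon>\<in>?E. of_int (\<Prod>i=1..u. \<epsilon> i) * (real (card (C \<epsilon>)) / (fact (2 * n))\<^sup>2))"
    by (simp add: sum_divide_distrib)
  have "real (card (C \<epsilon>)) / (fact (2 * n))\<^sup>2 =
    real (card (arrangements n u k l \<epsilon>)) / (fact (card (symbX n u k l)) * fact (card (symbY n u k l)))" for \<epsilon>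
  proof -
    have "real (card (C \<epsilon>) * (fact (card (symbX n u k l)) * fact (card (symbY n u k l)))) =
      real (card (arrangements n u k l \<epsilon>) * (fact (2 * n))\<^sup>2)"
      unfolding C_def g_def card_inducing_signs[OF assms] ..
    then show ?thesis by (simp add: field_simps)
  qed
  then show ?thesis unfolding sum by (simp only:)
qed

subsection \<open>The leading coefficient\<close>

lemma pair_typesD:
  assumes "P \<in> pair_types u"
  shows "is_type u P" "card P = u div 2" "\<And>p. p \<in> P \<Longrightarrow> weight p = 2"
  using assms unfolding pair_types_def by auto

lemma representsD:
  assumes "u \<ge> 1" "represents n k l u P Q"
  shows "u < n" "k ` {1..u} \<subseteq> {1..n}" "l ` {1..u} \<subseteq> {1..n}" "type_of n u k = P" "type_of n u l = Q"
  using assms unfolding represents_def by (auto simp: PiE_iff)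

lemma card_symbols_pair_types:
  assumes "u \<ge> 1" "P \<in> pair_types u" "Q \<in> pair_types u" "represents n k l u P Q"
  shows "card (symbX n u k l) = num_symb u P Q" "card (symbY n u k l) = num_symb u P Q"
  using card_symbols[OF representsD[OF assms(1,4)]] pair_typesD(2)[OF assms(2)] pair_typesD(2)[OF assms(3)]
  unfolding num_symb_def by auto

text \<open>The normalised sign sum shared by all \<open>k\<close> of type \<open>P\<close> and
  \<open>l\<close> of type \<open>Q\<close> once \<open>n \<ge> 2 * u\<close>, hence the
  contribution of the pair to the leading coefficient.\<close>

definition pair_term :: "nat \<Rightarrow> nat set list set \<Rightarrow> nat set list set \<Rightarrow> real" where
  "pair_term u P Q = (\<Sum>\<epsilon>\<in>{1..u} \<rightarrow>\<^sub>E {-1, 1 :: int}.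
     of_int (\<Prod>i=1..u. \<epsilon> i) * (real (num_arr u P Q \<epsilon>) / (fact (num_symb u P Q))\<^sup>2))"

lemma sign_sum_pair_types:
  assumes u: "u \<ge> 1" and PQ: "P \<in> pair_types u" "Q \<in> pair_types u" and n: "2 * u \<le> n"
    and kl: "k \<in> of_type n u P" "l \<in> of_type n u Q"
  shows "real_of_int (sign_sum n u k l) / (fact (2 * n))\<^sup>2 = pair_term u P Q"
proof -
  have rep: "represents n k l u P Q" using kl n unfolding of_type_def represents_def by simp
  note r = representsD[OF u rep]
  have "n > 0" using r(1) by simp
  show ?thesis
    unfolding sign_sum_eq_arrangements[OF \<open>n > 0\<close> r(2,3)] pair_term_def num_arr_eq[OF u rep]
      card_symbols_pair_types[OF u PQ rep]
    unfolding power2_eq_square ..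
qed

definition type_block :: "nat \<Rightarrow> nat \<Rightarrow> nat set list set \<Rightarrow> nat set list set \<Rightarrow> real" where
  "type_block n u P Q = (\<Sum>k\<in>of_type n u P. \<Sum>l\<in>of_type n u Q.
     real_of_int (sign_sum n u k l) / (fact (2 * n))\<^sup>2)"

lemma lk_moment_eq_type_blocks:
  assumes "u < n"
  shows "lk_moment u n = (\<Sum>P\<in>{P. is_type u P}. \<Sum>Q\<in>{P. is_type u P}. type_block n u P Q)"
proof -
  let ?K = "{1..u} \<rightarrow>\<^sub>E {1..n}" and ?T = "{P. is_type u P}"
  have fin: "finite ?K" by (simp add: finite_PiE)
  have sub: "type_of n u ` ?K \<subseteq> ?T"
  proof (intro image_subsetI)
    fix k assume "k \<in> ?K"
    then have "k ` {1..u} \<subseteq> {1..n}" by blast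
    then show "type_of n u k \<in> ?T" using type_of_spread(1)[OF assms] by simp
  qed
  have group: "(\<Sum>P\<in>?T. \<Sum>k\<in>of_type n u P. f k) = sum f ?K" for f :: "_ \<Rightarrow> real"
    unfolding of_type_def by (rule sum.group[OF fin finite_is_type sub])
  have "(\<Sum>P\<in>?T. \<Sum>Q\<in>?T. type_block n u P Q) =
    (\<Sum>P\<in>?T. \<Sum>k\<in>of_type n u P. \<Sum>Q\<in>?T. \<Sum>l\<in>of_type n u Q.
      real_of_int (sign_sum n u k l) / (fact (2 * n))\<^sup>2)"
    unfolding type_block_def by (intro sum.cong refl sum.swap)
  also have "\<dots> = lk_moment u n" unfolding group lk_moment_eq_sign_sum ..
  finally show ?thesis ..
qed

lemma type_block_zero:
  assumes un: "u < n" and w: "(\<exists>p\<in>P. weight p = 1) \<or> (\<exists>q\<in>Q. weight q = 1)"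
  shows "type_block n u P Q = 0"
  unfolding type_block_def
proof (intro sum.neutral ballI)
  fix k l assume "k \<in> of_type n u P" "l \<in> of_type n u Q"
  then have kl: "k ` {1..u} \<subseteq> {1..n}" "l ` {1..u} \<subseteq> {1..n}" "type_of n u k = P" "type_of n u l = Q"
    unfolding of_type_def by (auto simp: PiE_iff)
  have "sign_sum n u k l = 0"
    using w sign_sum_zero_left[OF un kl(1,2)] sign_sum_zero_right[OF un kl(1,2)] kl(3,4) by blast
  then show "real_of_int (sign_sum n u k l) / (fact (2 * n))\<^sup>2 = 0" by simp
qed

text \<open>All weights are at least 2 and they sum to \<open>2 * m\<close>; having \<open>m\<close>
  members leaves no room for a larger weight.\<close>

lemma card_type_le:
  assumes P: "is_type u P" and w: "\<forall>p\<in>P. weight p \<noteq> 1" and u: "u = 2 * m"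
  shows "card P \<le> m" and "card P = m \<longleftrightarrow> P \<in> pair_types u"
proof -
  have fin: "finite P" by (rule is_type_finite[OF P])
  have w2: "2 \<le> weight p" if "p \<in> P" for p
  proof -
    have "length p > 0" using is_type_Nil_notin[OF P that] by simp
    moreover have "weight p \<noteq> 1" using w that by blast
    ultimately show ?thesis using length_le_weight[OF P that] by linarith
  qed
  have sum: "(\<Sum>p\<in>P. weight p) = 2 * m" using sum_weight[OF P] u by simp
  have "(\<Sum>p\<in>P. 2) \<le> (\<Sum>p\<in>P. weight p)" by (rule sum_mono[OF w2])
  then show "card P \<le> m" using sum by simp
  show "card P = m \<longleftrightarrow> P \<in> pair_types u"
  proof
    assume c: "card P = m"
    have "weight p = 2" if "p \<in> P" for p
    proof (rule ccontr)
      assume "weight p \<noteq> 2"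
      then have "2 < weight p" using w2[OF that] by simp
      then have "(\<Sum>p\<in>P. 2) < (\<Sum>p\<in>P. weight p)"
        using w2 that by (intro sum_strict_mono_ex1[OF fin]) auto
      then show False using sum c by simp
    qed
    then show "P \<in> pair_types u" using P c u unfolding pair_types_def by simp
  next
    assume "P \<in> pair_types u"
    then show "card P = m" using u by (simp add: pair_types_def)
  qed
qed

lemma card_of_type_limit:
  assumes P: "is_type u P" and w: "\<forall>p\<in>P. weight p \<noteq> 1" and u: "u = 2 * m"
  shows "(\<lambda>n. real (card (of_type n u P)) / real n ^ m) \<longlonglongrightarrow> (if P \<in> pair_types u then 1 else 0)"
proof -
  have le: "card P \<le> m" and eq: "card P = m \<longleftrightarrow> P \<in> pair_types u" using card_type_le[OF assms] by auto
  have "(\<lambda>n. inverse (real n) ^ (m - card P)) \<longlonglongrightarrow> 0 ^ (m - card P)"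
    by (intro tendsto_power tendsto_inverse_0_at_top filterlim_real_sequentially)
  from tendsto_mult[OF card_of_type_asymptotics[OF P] this]
  have lim: "(\<lambda>n. real (card (of_type n u P)) / real n ^ card P * inverse (real n) ^ (m - card P)) \<longlonglongrightarrow>
    0 ^ (m - card P)" by simp
  have "real n ^ m = real n ^ card P * real n ^ (m - card P)" for n
    using le by (simp add: power_add[symmetric])
  then have "(\<lambda>n. real (card (of_type n u P)) / real n ^ card P * inverse (real n) ^ (m - card P)) =
    (\<lambda>n. real (card (of_type n u P)) / real n ^ m)"
    by (simp add: field_simps power_inverse)
  \<comment> \<open>The convention \<open>0 ^ 0 = 1\<close> lets one expression cover both the full
    and the deficient number of members.\<close>
  moreover have "(0::real) ^ (m - card P) = (if P \<in> pair_types u then 1 else 0)"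
    using le eq by (cases "card P = m") auto
  ultimately show ?thesis using lim by simp
qed

text \<open>A weight 1 makes the block vanish. Otherwise the number of pairs \<open>(k, l)\<close>
  is compared with \<open>n ^ u\<close>: for two pair types the ratio tends to 1 and all terms
  agree, in the remaining cases it tends to 0 and the terms are bounded by 1.\<close>

lemma type_block_limit:
  assumes u: "u \<ge> 1" "even u" and PQ: "is_type u P" "is_type u Q"
  shows "(\<lambda>n. type_block n u P Q / real n ^ u) \<longlonglongrightarrow>
    (if P \<in> pair_types u \<and> Q \<in> pair_types u then pair_term u P Q else 0)"
proof (cases "(\<exists>p\<in>P. weight p = 1) \<or> (\<exists>q\<in>Q. weight q = 1)")
  case True
  then have "\<not> (P \<in> pair_types u \<and> Q \<in> pair_types u)" using pair_typesD(3) by fastforce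
  moreover have "\<forall>\<^sub>F n in sequentially. type_block n u P Q / real n ^ u = 0"
    using eventually_gt_at_top[of u] by eventually_elim (simp add: type_block_zero[OF _ True])
  then have "(\<lambda>n. type_block n u P Q / real n ^ u) \<longlonglongrightarrow> 0" by (rule tendsto_eventually)
  ultimately show ?thesis by (simp only: if_False)
next
  case False
  then have w: "\<forall>p\<in>P. weight p \<noteq> 1" "\<forall>q\<in>Q. weight q \<noteq> 1" by auto
  obtain m where m: "u = 2 * m" using u(2) by blast
  define M where "M n P = real (card (of_type n u P))" for n P
  have pow: "real n ^ u = real n ^ m * real n ^ m" for n
    unfolding m by (simp add: mult_2 power_add)
  have "(\<lambda>n. (M n P / real n ^ m) * (M n Q / real n ^ m)) \<longlonglongrightarrow>
    (if P \<in> pair_types u then 1 else 0) * (if Q \<in> pair_types u then 1 else 0)"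
    unfolding M_def by (intro tendsto_mult card_of_type_limit PQ w m)
  also have "(if P \<in> pair_types u then 1 else 0) * (if Q \<in> pair_types u then 1 else 0) =
    (if P \<in> pair_types u \<and> Q \<in> pair_types u then 1 else (0::real))" by simp
  finally have lim: "(\<lambda>n. M n P * M n Q / real n ^ u) \<longlonglongrightarrow>
    (if P \<in> pair_types u \<and> Q \<in> pair_types u then 1 else 0)"
    unfolding pow by (simp only: times_divide_times_eq)
  show ?thesis
  proof (cases "P \<in> pair_types u \<and> Q \<in> pair_types u")
    case True
    have ev: "\<forall>\<^sub>F n in sequentially. M n P * M n Q / real n ^ u * pair_term u P Q = type_block n u P Q / real n ^ u"
      using eventually_ge_at_top[of "2 * u"]
    proof eventually_elim
      case (elim n)
      have "type_block n u P Q = (\<Sum>k\<in>of_type n u P. \<Sum>l\<in>of_type n u Q. pair_term u P Q)"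
        unfolding type_block_def using True elim by (intro sum.cong refl sign_sum_pair_types u(1)) auto
      then show ?case by (simp add: M_def)
    qed
    have "(\<lambda>n. M n P * M n Q / real n ^ u * pair_term u P Q) \<longlonglongrightarrow> 1 * pair_term u P Q"
      using lim True by (intro tendsto_mult tendsto_const) simp
    from Lim_transform_eventually[OF this ev] show ?thesis using True by simp
  next
    case False
    have le: "norm (type_block n u P Q / real n ^ u) \<le> M n P * M n Q / real n ^ u" for n
    proof -
      have "\<bar>type_block n u P Q\<bar> \<le> (\<Sum>k\<in>of_type n u P. \<Sum>l\<in>of_type n u Q. 1)"
        unfolding type_block_def by (rule order_trans[OF sum_abs], rule sum_mono,
          rule order_trans[OF sum_abs], rule sum_mono, rule abs_sign_sum_le)
      then have "\<bar>type_block n u P Q\<bar> \<le> M n P * M n Q" by (simp add: M_def)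
      then show ?thesis by (simp add: divide_right_mono)
    qed
    have "(\<lambda>n. M n P * M n Q / real n ^ u) \<longlonglongrightarrow> 0" using lim unfolding if_not_P[OF False] .
    then have "(\<lambda>n. type_block n u P Q / real n ^ u) \<longlonglongrightarrow> 0"
      by (rule Lim_null_comparison[OF always_eventually[OF allI[OF le]]])
    then show ?thesis unfolding if_not_P[OF False] .
  qed
qed

lemma pair_types_subset: "pair_types u \<subseteq> {P. is_type u P}"
  unfolding pair_types_def by blast

lemma lk_moment_limit:
  assumes u: "u \<ge> 1" "even u"
  shows "(\<lambda>n. lk_moment u n / real n ^ u) \<longlonglongrightarrow>
    (\<Sum>P\<in>pair_types u. \<Sum>Q\<in>pair_types u. pair_term u P Q)"
proof -
  let ?T = "{P. is_type u P}"
  let ?t = "\<lambda>P Q. if P \<in> pair_types u \<and> Q \<in> pair_types u then pair_term u P Q else 0"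
  have "(\<lambda>n. \<Sum>P\<in>?T. \<Sum>Q\<in>?T. type_block n u P Q / real n ^ u) \<longlonglongrightarrow> (\<Sum>P\<in>?T. \<Sum>Q\<in>?T. ?t P Q)"
    by (intro tendsto_sum type_block_limit u) auto
  moreover have "\<forall>\<^sub>F n in sequentially.
    (\<Sum>P\<in>?T. \<Sum>Q\<in>?T. type_block n u P Q / real n ^ u) = lk_moment u n / real n ^ u"
    using eventually_gt_at_top[of u]
    by eventually_elim (simp add: lk_moment_eq_type_blocks sum_divide_distrib)
  ultimately have "(\<lambda>n. lk_moment u n / real n ^ u) \<longlonglongrightarrow> (\<Sum>P\<in>?T. \<Sum>Q\<in>?T. ?t P Q)"
    by (simp add: tendsto_cong)
  also have "(\<Sum>P\<in>?T. \<Sum>Q\<in>?T. ?t P Q) = (\<Sum>P\<in>pair_types u. \<Sum>Q\<in>?T. ?t P Q)"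
    by (rule sum.mono_neutral_right[OF finite_is_type pair_types_subset]) simp
  also have "\<dots> = (\<Sum>P\<in>pair_types u. \<Sum>Q\<in>pair_types u. ?t P Q)"
    by (intro sum.cong refl sum.mono_neutral_right[OF finite_is_type pair_types_subset]) simp
  also have "\<dots> = (\<Sum>P\<in>pair_types u. \<Sum>Q\<in>pair_types u. pair_term u P Q)"
    by (intro sum.cong refl) simp
  finally show ?thesis .
qed

section \<open>Reading off polynomial coefficients from limits\<close>

lemma poly_over_power_tendsto:
  fixes p :: "real poly"
  assumes "degree p \<le> d"
  shows "(\<lambda>n. poly p (real n) / real n ^ d) \<longlonglongrightarrow> coeff p d"
proof -
  have "(\<lambda>n. \<Sum>i\<le>d. coeff p i * (real n ^ i / real n ^ d)) \<longlonglongrightarrow> (\<Sum>i\<le>d. coeff p i * (if i = d then 1 else 0))"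
  proof (intro tendsto_sum tendsto_mult tendsto_const)
    fix i assume i: "i \<in> {..d}"
    have "(\<lambda>n. inverse (real n) ^ (d - i)) \<longlonglongrightarrow> 0 ^ (d - i)"
      by (intro tendsto_power tendsto_inverse_0_at_top filterlim_real_sequentially)
    moreover have "\<forall>\<^sub>F n in sequentially. inverse (real n) ^ (d - i) = real n ^ i / real n ^ d"
      using eventually_gt_at_top[of 0]
    proof eventually_elim
      case (elim n)
      have "real n ^ d = real n ^ i * real n ^ (d - i)" using i by (simp add: power_add[symmetric])
      then show ?case using elim by (simp add: field_simps power_inverse)
    qed
    moreover have "(0::real) ^ (d - i) = (if i = d then 1 else 0)" using i by simp
    ultimately show "(\<lambda>n. real n ^ i / real n ^ d) \<longlonglongrightarrow> (if i = d then 1 else 0)"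
      by (simp add: tendsto_cong)
  qed
  moreover have "(\<Sum>i\<le>d. coeff p i * (if i = d then 1 else 0)) = coeff p d"
    by (simp add: if_distrib cong: if_cong)
  moreover have "poly p x = (\<Sum>i\<le>d. coeff p i * x ^ i)" for x
    using assms by (subst poly_altdef, intro sum.mono_neutral_left) (auto simp: coeff_eq_0)
  ultimately show ?thesis by (simp add: sum_divide_distrib)
qed

text \<open>The degree is not bounded in advance. Were it larger than \<open>d\<close>, dividing by
  the higher power of \<open>n\<close> would give limit 0, although that limit is the nonzero
  leading coefficient.\<close>

lemma coeff_eq_limit:
  fixes p :: "real poly"
  assumes lim: "(\<lambda>n. poly p (real n) / real n ^ d) \<longlonglongrightarrow> a"
  shows "coeff p d = a"
proof (cases "degree p \<le> d")
  case True
  then show ?thesis using LIMSEQ_unique[OF poly_over_power_tendsto lim] by blast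
next
  case False
  let ?e = "degree p"
  have "(\<lambda>n. inverse (real n) ^ (?e - d)) \<longlonglongrightarrow> 0 ^ (?e - d)"
    by (intro tendsto_power tendsto_inverse_0_at_top filterlim_real_sequentially)
  moreover have "(0::real) ^ (?e - d) = 0" using False by simp
  ultimately have "(\<lambda>n. inverse (real n) ^ (?e - d)) \<longlonglongrightarrow> 0" by (simp only:)
  from tendsto_mult[OF lim this]
  have "(\<lambda>n. poly p (real n) / real n ^ d * inverse (real n) ^ (?e - d)) \<longlonglongrightarrow> 0" by simp
  moreover have "real n ^ ?e = real n ^ d * real n ^ (?e - d)" for n
    using False by (simp add: power_add[symmetric])
  ultimately have "(\<lambda>n. poly p (real n) / real n ^ ?e) \<longlonglongrightarrow> 0"
    by (simp add: field_simps power_inverse)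
  then have "coeff p ?e = 0" using LIMSEQ_unique[OF poly_over_power_tendsto[OF order_refl]] by blast
  then show ?thesis using False by (simp add: leading_coeff_0_iff)
qed

theorem mainTheorem3:
  fixes u :: nat and p :: "real poly"
  assumes "u \<ge> 1"
    and p: "\<And>n. n > u \<Longrightarrow> lk_moment u n = poly p (real n)"
  shows "(odd u \<longrightarrow> p = 0) \<and>
    (even u \<longrightarrow>
      coeff p u =
        (\<Sum>P\<in>pair_types u. \<Sum>Q\<in>pair_types u. \<Sum>\<epsilon>\<in>{1..u} \<rightarrow>\<^sub>E {-1, 1 :: int}.
          of_int (\<Prod>i=1..u. \<epsilon> i) * (real (num_arr u P Q \<epsilon>) / (fact (num_symb u P Q))\<^sup>2)) \<and>
      (\<forall>P\<in>pair_types u. \<forall>Q\<in>pair_types u. \<forall>n k l. represents n k l u P Q \<longrightarrow>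
        card (symbX n u k l) = num_symb u P Q \<and> card (symbY n u k l) = num_symb u P Q))"
proof (intro conjI impI ballI allI)
  show "p = 0" if "odd u"
  proof (rule ccontr)
    assume "p \<noteq> 0"
    \<comment> \<open>All integers above \<open>u\<close> are roots of \<open>p\<close> because the
      odd moments vanish, which is too many for a nonzero polynomial.\<close>
    then have "finite {x. poly p x = 0}" by (rule poly_roots_finite)
    moreover have "real ` {u<..} \<subseteq> {x. poly p x = 0}" using p lk_moment_odd[OF that] by auto
    ultimately have "finite (real ` {u<..})" by (rule finite_subset[rotated])
    then have "finite {u<..}" by (rule finite_imageD) (simp add: inj_on_def)
    then show False using infinite_Ioi by blast
  qed
  assume u: "even u"
  \<comment> \<open>The moments agree with \<open>p\<close> for large \<open>n\<close>, so their
    limit after division by \<open>n ^ u\<close> identifies the coefficient.\<close>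
  have "\<forall>\<^sub>F n in sequentially. lk_moment u n / real n ^ u = poly p (real n) / real n ^ u"
    using eventually_gt_at_top[of u] by eventually_elim (simp add: p)
  with lk_moment_limit[OF assms(1) u] have "(\<lambda>n. poly p (real n) / real n ^ u) \<longlonglongrightarrow>
    (\<Sum>P\<in>pair_types u. \<Sum>Q\<in>pair_types u. pair_term u P Q)"
    by (simp add: tendsto_cong)
  then show "coeff p u = (\<Sum>P\<in>pair_types u. \<Sum>Q\<in>pair_types u. \<Sum>\<epsilon>\<in>{1..u} \<rightarrow>\<^sub>E {-1, 1 :: int}.
    of_int (\<Prod>i=1..u. \<epsilon> i) * (real (num_arr u P Q \<epsilon>) / (fact (num_symb u P Q))\<^sup>2))"
    unfolding pair_term_def by (rule coeff_eq_limit)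
  fix P Q n k l assume PQ: "P \<in> pair_types u" "Q \<in> pair_types u" and r: "represents n k l u P Q"
  show "card (symbX n u k l) = num_symb u P Q" "card (symbY n u k l) = num_symb u P Q"
    using card_symbols_pair_types[OF assms(1) PQ r] by auto
qed

end
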